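(* Let $\Omega\subset\mathbb R^n$ be a Borel set, let $x\in\hat\Omega$, let $f\in L^1_{\rm loc}(\Omega,\mathbb R^m)$, and let $\alpha\in\mathbb R^m$. (1) $f$ is essentially differentiable at $x$ with $\alpha$ if and only if $f$ is (precisely) differentiable at $x$ with $\alpha$. In this case $$Df(x)=D_{\rm es}f(x)$$ and $$\alpha=\operatorname*{ess\,lim}_{y\to x}f(y)=\mathrm{pr}f(x)=f^\star(x)=\int_\Omega f\,d\,\mathrm{dens}_x\quad\text{for all }\mathrm{dens}_x\in\mathrm{Dens}_x .\qquad( * )$$ (2) If $f$ has a representative $\tilde f$ that is differentiable at $x$ with $\alpha$, then $f$ is (precisely) differentiable at $x$ with $\alpha$ such that $Df(x)=D\tilde f(x)$ and $\alpha$ satisfies $( * )$.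
   Context: $\mathcal L^n$ is Lebesgue measure, $\mathcal B(\Omega)$ the Borel subsets of $\Omega$. $L^1_{\rm loc}(\Omega,\mathbb R^m)$ is the usual space of classes of $\mathcal L^n$-a.e. equal locally Lebesgue integrable functions. $\mathrm{ba}(\Omega,\mathcal B(\Omega),\mathcal L^n)$ is the space of bounded finitely additive set functions $\mu:\mathcal B(\Omega)\to\mathbb R$ with $\mu(A)=0$ whenever $\mathcal L^n(A)=0$. Integral: for $\mu\ge0$ in this space put $\mu^*(A)=\inf\{\mu(B):A\subset B\in\mathcal B(\Omega)\}$. A function $g:\Omega\to\mathbb R$ is $\mu$-integrable if there are Borel step functions $h_k$ with $\mu^*(\{|h_k-g|>\varepsilon\})\to0$ for all $\varepsilon>0$ and $\int_\Omega|h_k-h_l|\,d\mu\to0$; then $\int_\Omega g\,d\mu=\lim_k\int_\Omega h_k\,d\mu$. This depends only on the $\mathcal L^n$-a.e. class of $g$; vector functions are treated componentwise. $\hat\Omega:=\{x\in\overline\Omega:\mathcal L^n(\Omega\cap B_\delta(x))>0\ \forall\delta>0\}$. For $x\in\hat\Omega$: $\mathrm{Dens}_x$ is the set of $\mu\in\mathrm{ba}(\Omega,\mathcal B(\Omega),\mathcal L^n)$ with $\mu\ge0$ and $\mu(B_\delta(x)\cap\Omega)=\mu(\Omega)=1$ for all $\delta>0$; $\mathcal L^n\text{-}\mathrm{Dens}_x^\Omega$ is the set of all $\mu\in\mathrm{ba}(\Omega,\mathcal B(\Omega),\mathcal L^n)$ with $$\liminf_{\delta\downarrow0}\frac{\mathcal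 L^n(A\cap\Omega\cap B_\delta(x))}{\mathcal L^n(\Omega\cap B_\delta(x))}\le\mu(A)\le\limsup_{\delta\downarrow0}\frac{\mathcal L^n(A\cap\Omega\cap B_\delta(x))}{\mathcal L^n(\Omega\cap B_\delta(x))}\quad\forall A\in\mathcal B(\Omega).$$ Precise representatives at $y\in\hat\Omega$: $f^\star(y)=\lim_{\delta\downarrow0}\frac1{\mathcal L^n(B_\delta(y)\cap\Omega)}\int_{B_\delta(y)\cap\Omega}f\,d\mathcal L^n$ if the limit exists; $\mathrm{pr}f(y)=\int_\Omega f\,d\,\mathrm{dens}_y^\Omega$ for a selected $\mathrm{dens}_y^\Omega\in\mathcal L^n\text{-}\mathrm{Dens}_y^\Omega$. "$\mathrm{pr}f$ exists as integral" at $y$ means that this integral exists for at least one $\mathrm{dens}_y^\Omega\in\mathcal L^n\text{-}\mathrm{Dens}_y^\Omega$, and then $\mathrm{pr}f(y)$ is always such an existing integral. $\operatorname{ess\,lim}_{y\to x}g(y)=\beta$ means $\lim_{\delta\downarrow0}\operatorname{ess\,sup}_{B_\delta(x)\cap\Omega}|g-\beta|=0$. Notions of differentiability at $x\in\hat\Omega$ with $\alpha\in\mathbb R^m$ and a linear map $L:\mathbb R^n\to\mathbb R^m$: (a) $f$ is essentially differentiable at $x$ with $\alpha$, $D_{\rm es}f(x):=L$, if $\operatorname{ess\,lim}_{y\to x}\frac{f(y)-\alpha-L(y-x)}{|y-x|}=0$. (b) A representative $\tilde f:\Omega\to\mathbb R^m$ of $f$ is differentiable at $x$ with $\alpha$,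 $D\tilde f(x):=L$, if $\lim_{y\to x,\,y\in\Omega}\frac{\tilde f(y)-\alpha-L(y-x)}{|y-x|}=0$ (with $y\neq x$; $\alpha$ need not equal $\tilde f(x)$). (c) $f$ is (precisely) differentiable at $x$ with $\alpha$, $Df(x):=L$, if $\mathrm{pr}f$ exists as integral on $B_\delta(x)\cap\hat\Omega$ for some $\delta>0$ and $\lim_{y\to x,\,y\in\Omega\cap\hat\Omega}\frac{\mathrm{pr}f(y)-\alpha-L(y-x)}{|y-x|}=0$ (with $y\ne x$), for some selection of measures $\mathrm{dens}_y^\Omega\in\mathcal L^n\text{-}\mathrm{Dens}_y^\Omega$ for which the integrals $\mathrm{pr}f(y)=\int_\Omega f\,d\,\mathrm{dens}_y^\Omega$ exist. *)

theory Defs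
  imports "HOL-Analysis.Analysis" "HOL-Probability.Essential_Supremum"
begin

text \<open>
  Elements of \<open>ba \<Omega>\<close> are total functions on sets; only their values on \<open>borel_subsets \<Omega>\<close>
  are ever used.
\<close>

abbreviation borel_subsets :: "'a::topological_space set \<Rightarrow> 'a set set" where
  "borel_subsets \<Omega> \<equiv> sets (restrict_space borel \<Omega>)"

definition ba :: "(real^'n) set \<Rightarrow> ((real^'n) set \<Rightarrow> real) set" where
  "ba \<Omega> = {\<mu>.
     (\<forall>A\<in>borel_subsets \<Omega>. \<forall>B\<in>borel_subsets \<Omega>. A \<inter> B = {} \<longrightarrow> \<mu> (A \<union> B) = \<mu> A + \<mu> B) \<and>
     (\<exists>C. \<forall>A\<in>borel_subsets \<Omega>. \<bar>\<mu> A\<bar> \<le> C) \<and>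
     (\<forall>A\<in>borel_subsets \<Omega>. emeasure lebesgue A = 0 \<longrightarrow> \<mu> A = 0)}"

definition outer_ba :: "(real^'n) set \<Rightarrow> ((real^'n) set \<Rightarrow> real) \<Rightarrow> (real^'n) set \<Rightarrow> real" where
  "outer_ba \<Omega> \<mu> A = Inf (\<mu> ` {B \<in> borel_subsets \<Omega>. A \<subseteq> B})"

definition step_integral ::
    "(real^'n) set \<Rightarrow> ((real^'n) set \<Rightarrow> real) \<Rightarrow> (real^'n \<Rightarrow> real) \<Rightarrow> real" where
  "step_integral \<Omega> \<mu> h = (\<Sum>v\<in>h ` \<Omega>. v * \<mu> (h -` {v} \<inter> \<Omega>))"

definition determining_seq ::
    "(real^'n) set \<Rightarrow> ((real^'n) set \<Rightarrow> real) \<Rightarrow> (real^'n \<Rightarrow> real) \<Rightarrow> (nat \<Rightarrow> real^'n \<Rightarrow> real) \<Rightarrow> bool" where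
  "determining_seq \<Omega> \<mu> g h \<longleftrightarrow>
     (\<forall>k. simple_function (restrict_space borel \<Omega>) (h k)) \<and>
     (\<forall>\<epsilon>>0. (\<lambda>k. outer_ba \<Omega> \<mu> {y\<in>\<Omega>. \<bar>h k y - g y\<bar> > \<epsilon>}) \<longlonglongrightarrow> 0) \<and>
     (\<forall>\<epsilon>>0. \<exists>N. \<forall>k\<ge>N. \<forall>l\<ge>N. \<bar>step_integral \<Omega> \<mu> (\<lambda>y. \<bar>h k y - h l y\<bar>)\<bar> < \<epsilon>)"

definition ba_integrable_real ::
    "(real^'n) set \<Rightarrow> ((real^'n) set \<Rightarrow> real) \<Rightarrow> (real^'n \<Rightarrow> real) \<Rightarrow> bool" where
  "ba_integrable_real \<Omega> \<mu> g \<longleftrightarrow> (\<exists>h. determining_seq \<Omega> \<mu> g h)"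

text \<open>Meaningful for integrable functions and nonnegative \<open>\<mu>\<close>, where the limit does not depend
  on the determining sequence.\<close>

definition ba_integral_real ::
    "(real^'n) set \<Rightarrow> ((real^'n) set \<Rightarrow> real) \<Rightarrow> (real^'n \<Rightarrow> real) \<Rightarrow> real" where
  "ba_integral_real \<Omega> \<mu> g =
     (THE I. \<exists>h. determining_seq \<Omega> \<mu> g h \<and> (\<lambda>k. step_integral \<Omega> \<mu> (h k)) \<longlonglongrightarrow> I)"

definition ba_integrable ::
    "(real^'n) set \<Rightarrow> ((real^'n) set \<Rightarrow> real) \<Rightarrow> (real^'n \<Rightarrow> real^'m) \<Rightarrow> bool" where
  "ba_integrable \<Omega> \<mu> f \<longleftrightarrow> (\<forall>i. ba_integrable_real \<Omega> \<mu> (\<lambda>y. f y $ i))"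

definition ba_integral ::
    "(real^'n) set \<Rightarrow> ((real^'n) set \<Rightarrow> real) \<Rightarrow> (real^'n \<Rightarrow> real^'m) \<Rightarrow> real^'m" where
  "ba_integral \<Omega> \<mu> f = (\<chi> i. ba_integral_real \<Omega> \<mu> (\<lambda>y. f y $ i))"

definition ess_closure :: "(real^'n) set \<Rightarrow> (real^'n) set" where
  "ess_closure \<Omega> = {x \<in> closure \<Omega>. \<forall>\<delta>>0. measure lebesgue (\<Omega> \<inter> ball x \<delta>) > 0}"

definition Dens :: "(real^'n) set \<Rightarrow> real^'n \<Rightarrow> ((real^'n) set \<Rightarrow> real) set" where
  "Dens \<Omega> x = {\<mu> \<in> ba \<Omega>.
     (\<forall>A\<in>borel_subsets \<Omega>. 0 \<le> \<mu> A) \<and> (\<forall>\<delta>>0. \<mu> (ball x \<delta> \<inter> \<Omega>) = 1) \<and> \<mu> \<Omega> = 1}"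

definition density_quotient :: "(real^'n) set \<Rightarrow> real^'n \<Rightarrow> (real^'n) set \<Rightarrow> real \<Rightarrow> real" where
  "density_quotient \<Omega> x A \<delta> =
     measure lebesgue (A \<inter> \<Omega> \<inter> ball x \<delta>) / measure lebesgue (\<Omega> \<inter> ball x \<delta>)"

definition Leb_Dens :: "(real^'n) set \<Rightarrow> real^'n \<Rightarrow> ((real^'n) set \<Rightarrow> real) set" where
  "Leb_Dens \<Omega> x = {\<mu> \<in> ba \<Omega>. \<forall>A\<in>borel_subsets \<Omega>.
     Liminf (at_right 0) (\<lambda>\<delta>. ereal (density_quotient \<Omega> x A \<delta>)) \<le> ereal (\<mu> A) \<and>
     ereal (\<mu> A) \<le> Limsup (at_right 0) (\<lambda>\<delta>. ereal (density_quotient \<Omega> x A \<delta>))}"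

text \<open>
  Elements of \<open>L1_loc \<Omega>\<close> are given by arbitrary members of their classes. For Borel sets that are
  not locally compact, integrability on the compact subsets is the weakest of the usual readings.
\<close>

definition L1_loc :: "(real^'n) set \<Rightarrow> (real^'n \<Rightarrow> real^'m) set" where
  "L1_loc \<Omega> = {f. f \<in> borel_measurable (lebesgue_on \<Omega>) \<and>
     (\<forall>K. compact K \<and> K \<subseteq> \<Omega> \<longrightarrow> integrable (lebesgue_on K) f)}"

definition representative_of ::
    "(real^'n) set \<Rightarrow> (real^'n \<Rightarrow> real^'m) \<Rightarrow> (real^'n \<Rightarrow> real^'m) \<Rightarrow> bool" where
  "representative_of \<Omega> f f' \<longleftrightarrow> (AE y in lebesgue_on \<Omega>. f' y = f y)"

text \<open>\<open>f\<^sup>\<star>(y)\<close> exists and equals \<open>v\<close>. Integrability is required explicitly since the Bochner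
  integral of a non-integrable function is \<open>0\<close> by convention.\<close>

definition has_star_value ::
    "(real^'n) set \<Rightarrow> (real^'n \<Rightarrow> real^'m) \<Rightarrow> real^'n \<Rightarrow> real^'m \<Rightarrow> bool" where
  "has_star_value \<Omega> f y v \<longleftrightarrow>
     eventually (\<lambda>\<delta>. integrable (lebesgue_on (ball y \<delta> \<inter> \<Omega>)) f) (at_right 0) \<and>
     ((\<lambda>\<delta>. (1 / measure lebesgue (ball y \<delta> \<inter> \<Omega>)) *\<^sub>R
            integral\<^sup>L (lebesgue_on (ball y \<delta> \<inter> \<Omega>)) f) \<longlongrightarrow> v) (at_right 0)"

definition pr_exists ::
    "(real^'n) set \<Rightarrow> (real^'n \<Rightarrow> real^'m) \<Rightarrow> real^'n \<Rightarrow> bool" where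
  "pr_exists \<Omega> f y \<longleftrightarrow> (\<exists>\<mu>\<in>Leb_Dens \<Omega> y. ba_integrable \<Omega> \<mu> f)"

text \<open>A selection of the measures \<open>dens\<^sub>y\<close>, admissible for \<open>f\<close>: wherever the integral exists
  for some choice, it exists for the selected one.\<close>

definition dens_selection ::
    "(real^'n) set \<Rightarrow> (real^'n \<Rightarrow> real^'m) \<Rightarrow> (real^'n \<Rightarrow> (real^'n) set \<Rightarrow> real) \<Rightarrow> bool" where
  "dens_selection \<Omega> f dens \<longleftrightarrow>
     (\<forall>y\<in>ess_closure \<Omega>. dens y \<in> Leb_Dens \<Omega> y \<and>
        (pr_exists \<Omega> f y \<longrightarrow> ba_integrable \<Omega> (dens y) f))"

definition pr ::
    "(real^'n) set \<Rightarrow> (real^'n \<Rightarrow> (real^'n) set \<Rightarrow> real) \<Rightarrow> (real^'n \<Rightarrow> real^'m) \<Rightarrow> real^'n \<Rightarrow> real^'m"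
  where "pr \<Omega> dens f y = ba_integral \<Omega> (dens y) f"

definition has_ess_lim ::
    "(real^'n) set \<Rightarrow> (real^'n \<Rightarrow> real^'m) \<Rightarrow> real^'n \<Rightarrow> real^'m \<Rightarrow> bool" where
  "has_ess_lim \<Omega> g x \<beta> \<longleftrightarrow>
     ((\<lambda>\<delta>. esssup (lebesgue_on (ball x \<delta> \<inter> \<Omega>)) (\<lambda>y. ereal (norm (g y - \<beta>)))) \<longlongrightarrow> 0)
       (at_right 0)"

definition diff_quotient ::
    "(real^'n \<Rightarrow> real^'m) \<Rightarrow> real^'n \<Rightarrow> real^'m \<Rightarrow> (real^'n \<Rightarrow> real^'m) \<Rightarrow> real^'n \<Rightarrow> real^'m" where
  "diff_quotient f x \<alpha> L y = (f y - \<alpha> - L (y - x)) /\<^sub>R norm (y - x)"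

text \<open>
  The derivative is an argument of the following predicates: for a general Borel set \<open>\<Omega>\<close>
  it need not be determined by the limit condition (for instance at the tip of a cusp).
\<close>

definition has_ess_deriv ::
    "(real^'n) set \<Rightarrow> (real^'n \<Rightarrow> real^'m) \<Rightarrow> real^'n \<Rightarrow> real^'m \<Rightarrow> (real^'n \<Rightarrow> real^'m) \<Rightarrow> bool" where
  "has_ess_deriv \<Omega> f x \<alpha> L \<longleftrightarrow> linear L \<and> has_ess_lim \<Omega> (diff_quotient f x \<alpha> L) x 0"

definition has_pointwise_deriv ::
    "(real^'n) set \<Rightarrow> (real^'n \<Rightarrow> real^'m) \<Rightarrow> real^'n \<Rightarrow> real^'m \<Rightarrow> (real^'n \<Rightarrow> real^'m) \<Rightarrow> bool" where
  "has_pointwise_deriv \<Omega> f x \<alpha> L \<longleftrightarrow>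
     linear L \<and> (diff_quotient f x \<alpha> L \<longlongrightarrow> 0) (at x within \<Omega>)"

definition has_precise_deriv ::
    "(real^'n) set \<Rightarrow> (real^'n \<Rightarrow> real^'m) \<Rightarrow> real^'n \<Rightarrow> real^'m \<Rightarrow> (real^'n \<Rightarrow> real^'m) \<Rightarrow> bool" where
  "has_precise_deriv \<Omega> f x \<alpha> L \<longleftrightarrow> linear L \<and>
     (\<exists>\<delta>>0. \<forall>y\<in>ball x \<delta> \<inter> ess_closure \<Omega>. pr_exists \<Omega> f y) \<and>
     (\<exists>dens. dens_selection \<Omega> f dens \<and>
        (diff_quotient (pr \<Omega> dens f) x \<alpha> L \<longlongrightarrow> 0) (at x within \<Omega> \<inter> ess_closure \<Omega>))"

text \<open>The chain of equalities
  \<open>\<alpha> = ess lim f = pr f(x) = f\<^sup>\<star>(x) = \<integral>f d dens\<^sub>x\<close>, including the existence of all the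
  quantities involved; \<open>pr f(x)\<close> is taken for every admissible selection.\<close>

definition value_identities ::
    "(real^'n) set \<Rightarrow> (real^'n \<Rightarrow> real^'m) \<Rightarrow> real^'n \<Rightarrow> real^'m \<Rightarrow> bool" where
  "value_identities \<Omega> f x \<alpha> \<longleftrightarrow>
     has_ess_lim \<Omega> f x \<alpha> \<and>
     pr_exists \<Omega> f x \<and> (\<forall>dens. dens_selection \<Omega> f dens \<longrightarrow> pr \<Omega> dens f x = \<alpha>) \<and>
     has_star_value \<Omega> f x \<alpha> \<and>
     (\<forall>\<mu>\<in>Dens \<Omega> x. ba_integrable \<Omega> \<mu> f \<and> ba_integral \<Omega> \<mu> f = \<alpha>)"

end

theory Submission
  imports Defs
begin

text \<open>
  Measures in \<open>Dens \<Omega> y\<close> live on every ball around \<open>y\<close>, so an essential bound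
  \<open>\<bar>f - c\<bar> \<le> K\<close> near \<open>y\<close> makes \<open>f\<close> integrable with an integral within a multiple of \<open>K\<close>
  of \<open>c\<close>. With \<open>c = \<alpha> + L (y - x)\<close> and radii tending to \<open>0\<close>, essential differentiability
  gives precise differentiability; with \<open>c = \<alpha>\<close> at \<open>y = x\<close> it gives the value identities.
  Conversely, by Lebesgue's density theorem \<open>f\<close> is approximately continuous at almost every
  \<open>y \<in> \<Omega>\<close>. There \<open>{z. \<bar>f z - f y\<bar> > \<epsilon>}\<close> has density \<open>0\<close>, hence is null for every
  \<open>\<mu> \<in> Leb_Dens \<Omega> y\<close>, so the constant sequence \<open>f y\<close> is determining and \<open>pr f = f\<close> almost
  everywhere, whatever the selection.
\<close>

section \<open>Integration with respect to finitely additive measures\<close>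

text \<open>The obstacle is that charges are only finitely additive and live on Borel sets, whereas
  \<open>f\<close> is Lebesgue measurable and known up to null sets. With no convergence theorem at
  hand, integrals are reached in just two ways: by uniform approximation off a Borel set of charge
  zero, when \<open>f\<close> is essentially bounded where the charge is concentrated, and by a
  constant determining sequence, when \<open>f\<close> agrees with a constant in measure. The second
  way calls for approximate continuity. Lebesgue points would require integrability of
  \<open>f\<close> near \<open>y\<close>, which integrability on compact subsets does not supply for
  a general Borel set \<Omega>. The exceptional null set comes from countably many preimages of
  rational intervals, so it is fixed before any measure is chosen; this matters because a selection
  of measures carries no regularity in \<open>y\<close>. Existence of \<open>pr f\<close> and of
  selections presupposes that \<open>Leb_Dens \<Omega> y\<close> is nonempty, which rests on
  compactness. The multiple of \<open>K\<close> is \<open>CARD('m)\<close>: integrals are taken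
  componentwise and the component errors are summed.\<close>

lemma borel_subsets_iff:
  assumes "\<Omega> \<in> sets borel"
  shows "A \<in> borel_subsets \<Omega> \<longleftrightarrow> A \<in> sets borel \<and> A \<subseteq> \<Omega>"
  using assms by (auto simp: sets_restrict_space_iff)

locale charge =
  fixes \<Omega> :: "(real^'n) set" and \<mu> :: "(real^'n) set \<Rightarrow> real"
  assumes Omega [measurable]: "\<Omega> \<in> sets borel"
    and ba: "\<mu> \<in> ba \<Omega>"
    and nonneg: "A \<in> borel_subsets \<Omega> \<Longrightarrow> 0 \<le> \<mu> A"
begin

abbreviation "\<B> \<equiv> borel_subsets \<Omega>"

lemma space_restrict [simp]: "space (restrict_space borel \<Omega>) = \<Omega>"
  by (simp add: space_restrict_space)

lemma union: "A \<in> \<B> \<Longrightarrow> B \<in> \<B> \<Longrightarrow> A \<inter> B = {} \<Longrightarrow> \<mu> (A \<union> B) = \<mu> A + \<mu> B"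
  using ba unfolding ba_def by blast

lemma null: "A \<in> \<B> \<Longrightarrow> emeasure lebesgue A = 0 \<Longrightarrow> \<mu> A = 0"
  using ba unfolding ba_def by blast

lemma empty [simp]: "\<mu> {} = 0"
  by (rule null) auto

lemma Omega_in: "\<Omega> \<in> \<B>"
  by (simp add: borel_subsets_iff[OF Omega])

lemma mono:
  assumes "A \<in> \<B>" "B \<in> \<B>" "A \<subseteq> B"
  shows "\<mu> A \<le> \<mu> B"
proof -
  have D: "B - A \<in> \<B>"
    by (intro sets.Diff assms)
  then have "\<mu> (A \<union> (B - A)) = \<mu> A + \<mu> (B - A)"
    using assms by (intro union) auto
  then show ?thesis
    using nonneg[OF D] assms by (simp add: Un_absorb1)
qed

lemma subadd:
  assumes "A \<in> \<B>" "B \<in> \<B>"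
  shows "\<mu> (A \<union> B) \<le> \<mu> A + \<mu> B"
proof -
  have D: "B - A \<in> \<B>"
    by (intro sets.Diff assms)
  then have "\<mu> (A \<union> (B - A)) = \<mu> A + \<mu> (B - A)" "\<mu> (B - A) \<le> \<mu> B"
    using assms by (intro union mono; blast)+
  then show ?thesis by simp
qed

lemma UN_disjoint:
  assumes "finite I" "\<And>i. i \<in> I \<Longrightarrow> A i \<in> \<B>" "disjoint_family_on A I"
  shows "\<mu> (\<Union>i\<in>I. A i) = (\<Sum>i\<in>I. \<mu> (A i))"
  using assms
proof (induction I rule: finite_induct)
  case (insert i I)
  have "\<mu> (A i \<union> (\<Union>i\<in>I. A i)) = \<mu> (A i) + \<mu> (\<Union>i\<in>I. A i)"
  proof (rule union)
    show "A i \<inter> (\<Union>i\<in>I. A i) = {}"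
      using insert.hyps(2) insert.prems(2) by (auto simp: disjoint_family_on_def)
  qed (use insert.hyps(1) insert.prems(1) in auto)
  also have "\<mu> (\<Union>i\<in>I. A i) = (\<Sum>i\<in>I. \<mu> (A i))"
    using insert.prems by (intro insert.IH) (auto simp: disjoint_family_on_def)
  finally show ?case using insert.hyps by simp
qed simp

section \<open>Step integrals with respect to a nonnegative charge\<close>

abbreviation "simple \<equiv> simple_function (restrict_space borel \<Omega>)"

text \<open>Taking for \<open>p\<close> a pair of step functions yields linearity and monotonicity.\<close>

lemma step_integral_comp:
  assumes p: "simple p"
  shows "step_integral \<Omega> \<mu> (\<lambda>y. F (p y)) = (\<Sum>c\<in>p ` \<Omega>. F c * \<mu> (p -` {c} \<inter> \<Omega>))"
proof -
  have fin: "finite (p ` \<Omega>)"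
    using simple_functionD(1)[OF p] by simp
  have meas: "p -` {c} \<inter> \<Omega> \<in> \<B>" for c
    using simple_functionD(2)[OF p, of "{c}"] by simp
  \<comment> \<open>\<open>F\<close> may merge several values of \<open>p\<close>; grouping the
    values by their image turns each inner sum into the charge of one level set of the
    composite.\<close>
  have "(\<Sum>c\<in>p ` \<Omega>. F c * \<mu> (p -` {c} \<inter> \<Omega>))
      = (\<Sum>v\<in>F ` p ` \<Omega>. \<Sum>c\<in>{c \<in> p ` \<Omega>. F c = v}. F c * \<mu> (p -` {c} \<inter> \<Omega>))"
    using fin by (rule sum.image_gen)
  also have "\<dots> = (\<Sum>v\<in>F ` p ` \<Omega>. v * \<mu> ((\<lambda>y. F (p y)) -` {v} \<inter> \<Omega>))"
  proof (rule sum.cong[OF refl])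
    fix v
    have "(\<lambda>y. F (p y)) -` {v} \<inter> \<Omega> = (\<Union>c\<in>{c \<in> p ` \<Omega>. F c = v}. p -` {c} \<inter> \<Omega>)"
      by auto
    also have "\<mu> \<dots> = (\<Sum>c\<in>{c \<in> p ` \<Omega>. F c = v}. \<mu> (p -` {c} \<inter> \<Omega>))"
      using fin meas by (intro UN_disjoint) (auto simp: disjoint_family_on_def)
    finally show "(\<Sum>c\<in>{c \<in> p ` \<Omega>. F c = v}. F c * \<mu> (p -` {c} \<inter> \<Omega>))
        = v * \<mu> ((\<lambda>y. F (p y)) -` {v} \<inter> \<Omega>)"
      by (simp add: sum_distrib_left)
  qed
  also have "\<dots> = step_integral \<Omega> \<mu> (\<lambda>y. F (p y))"
    by (simp add: step_integral_def image_image)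
  finally show ?thesis ..
qed

text \<open>The level sets of the pair form the common refinement of the two partitions. Hence the
  step integrals of \<open>g\<close>, of \<open>h\<close> and of any combination become sums over
  one index set and can be compared term by term.\<close>

lemma step_integral_pair:
  assumes "simple g" "simple h"
  shows "step_integral \<Omega> \<mu> (\<lambda>y. F (g y) (h y))
    = (\<Sum>c\<in>(\<lambda>y. (g y, h y)) ` \<Omega>. F (fst c) (snd c) * \<mu> ((\<lambda>y. (g y, h y)) -` {c} \<inter> \<Omega>))"
  using step_integral_comp[OF simple_function_Pair[OF assms], of "\<lambda>c. F (fst c) (snd c)"] by simp

lemma step_integral_mono:
  assumes "simple g" "simple h" "\<And>y. y \<in> \<Omega> \<Longrightarrow> g y \<le> h y"
  shows "step_integral \<Omega> \<mu> g \<le> step_integral \<Omega> \<mu> h"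
proof -
  have meas: "(\<lambda>y. (g y, h y)) -` {c} \<inter> \<Omega> \<in> \<B>" for c
    using simple_functionD(2)[OF simple_function_Pair[OF assms(1,2)], of "{c}"] by simp
  show ?thesis
    using step_integral_pair[OF assms(1,2), of "\<lambda>a b. a"]
      step_integral_pair[OF assms(1,2), of "\<lambda>a b. b"]
    by (auto intro!: sum_mono mult_right_mono nonneg meas assms(3))
qed

lemma step_integral_add:
  assumes "simple g" "simple h"
  shows "step_integral \<Omega> \<mu> (\<lambda>y. g y + h y) = step_integral \<Omega> \<mu> g + step_integral \<Omega> \<mu> h"
  using step_integral_pair[OF assms, of "\<lambda>a b. a"] step_integral_pair[OF assms, of "\<lambda>a b. b"]
    step_integral_pair[OF assms, of "\<lambda>a b. a + b"]
  by (simp add: sum.distrib[symmetric] distrib_right)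

lemma step_integral_uminus:
  assumes "simple g"
  shows "step_integral \<Omega> \<mu> (\<lambda>y. - g y) = - step_integral \<Omega> \<mu> g"
  using step_integral_comp[OF assms, of "\<lambda>a. a"] step_integral_comp[OF assms, of uminus]
  by (simp add: sum_negf)

lemma step_integral_diff:
  assumes "simple g" "simple h"
  shows "step_integral \<Omega> \<mu> (\<lambda>y. g y - h y) = step_integral \<Omega> \<mu> g - step_integral \<Omega> \<mu> h"
  using step_integral_add[of g "\<lambda>y. - h y"] step_integral_uminus[of h] assms
    simple_function_compose1[OF assms(2), of uminus]
  by simp

lemma step_integral_abs_diff:
  assumes "simple g" "simple h"
  shows "\<bar>step_integral \<Omega> \<mu> g - step_integral \<Omega> \<mu> h\<bar> \<le> step_integral \<Omega> \<mu> (\<lambda>y. \<bar>g y - h y\<bar>)"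
proof -
  have s: "simple (\<lambda>y. g y - h y)" "simple (\<lambda>y. \<bar>g y - h y\<bar>)" "simple (\<lambda>y. - (g y - h y))"
    using assms simple_function_compose2[OF assms, of "\<lambda>a b. \<bar>a - b\<bar>"]
      simple_function_compose2[OF assms, of "\<lambda>a b. - (a - b)"] by auto
  have "step_integral \<Omega> \<mu> (\<lambda>y. g y - h y) \<le> step_integral \<Omega> \<mu> (\<lambda>y. \<bar>g y - h y\<bar>)"
    "step_integral \<Omega> \<mu> (\<lambda>y. - (g y - h y)) \<le> step_integral \<Omega> \<mu> (\<lambda>y. \<bar>g y - h y\<bar>)"
    by (intro step_integral_mono s; simp)+
  then show ?thesis
    using step_integral_uminus[OF s(1)] step_integral_diff[OF assms] by linarith
qed

lemma simple_indicator:
  assumes "E \<in> \<B>"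
  shows "simple (\<lambda>y. if y \<in> E then c else (0::real))"
proof -
  have "simple (\<lambda>y. c * indicator E y)"
    using assms by (intro simple_function_mult simple_function_indicator) auto
  moreover have "(\<lambda>y. c * indicator E y) = (\<lambda>y. if y \<in> E then c else 0)"
    by auto
  ultimately show ?thesis by simp
qed

lemma step_integral_indicator:
  assumes "E \<in> \<B>"
  shows "step_integral \<Omega> \<mu> (\<lambda>y. if y \<in> E then c else 0) = c * \<mu> E"
proof -
  \<comment> \<open>Membership is treated as a Boolean step function. Computing the image of the
    real-valued function directly would need separate cases for \<open>c = 0\<close>, for empty
    \<open>E\<close> and for \<open>E = \<Omega>\<close>.\<close>
  let ?p = "\<lambda>y. y \<in> E"
  have E: "E \<subseteq> \<Omega>" using assms borel_subsets_iff[OF Omega] by blast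
  have s: "simple ?p"
  proof -
    have "(\<lambda>y. (if y \<in> E then 1 else 0 :: real) = 1) = ?p" by auto
    then show ?thesis
      using simple_function_compose1[OF simple_indicator[OF assms, of 1], of "\<lambda>v. v = 1"]
      by metis
  qed
  have "step_integral \<Omega> \<mu> (\<lambda>y. if y \<in> E then c else 0)
      = (\<Sum>b\<in>?p ` \<Omega>. (if b then c else 0) * \<mu> (?p -` {b} \<inter> \<Omega>))"
    by (rule step_integral_comp[OF s, of "\<lambda>b. if b then c else 0"])
  \<comment> \<open>A truth value that is not attained has an empty level set and contributes 0, so
    the sum may run over both.\<close>
  also have "\<dots> = (\<Sum>b\<in>UNIV. (if b then c else 0) * \<mu> (?p -` {b} \<inter> \<Omega>))"
  proof (rule sum.mono_neutral_left; (intro ballI)?)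
    fix b assume "b \<in> UNIV - ?p ` \<Omega>"
    then have "?p -` {b} \<inter> \<Omega> = {}" by auto
    then show "(if b then c else 0) * \<mu> (?p -` {b} \<inter> \<Omega>) = 0"
      by simp
  qed auto
  also have "\<dots> = c * \<mu> (?p -` {True} \<inter> \<Omega>)"
    by (simp add: UNIV_bool)
  also have "?p -` {True} \<inter> \<Omega> = E" using E by auto
  finally show ?thesis .
qed

lemma step_integral_const: "step_integral \<Omega> \<mu> (\<lambda>y. c) = c * \<mu> \<Omega>"
proof -
  have "step_integral \<Omega> \<mu> (\<lambda>y. c) = step_integral \<Omega> \<mu> (\<lambda>y. if y \<in> \<Omega> then c else 0)"
    unfolding step_integral_def by (rule sum.cong) (auto intro!: arg_cong[where f=\<mu>])
  then show ?thesis using step_integral_indicator[OF Omega_in] by simp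
qed

section \<open>Outer charge, and independence of the integral from the determining sequence\<close>

lemma outer_ge_0:
  assumes "S \<subseteq> \<Omega>"
  shows "0 \<le> outer_ba \<Omega> \<mu> S"
  \<comment> \<open>Because \<open>S\<close> lies in \<Omega>, the family of Borel covers contains
    \<Omega>; over an empty family \<open>Inf\<close> would carry no information.\<close>
  unfolding outer_ba_def
  using Omega_in assms nonneg by (intro cINF_greatest) auto

lemma outer_le:
  assumes "S \<subseteq> B" "B \<in> \<B>"
  shows "outer_ba \<Omega> \<mu> S \<le> \<mu> B"
  unfolding outer_ba_def
  using assms nonneg by (intro cINF_lower bdd_belowI2[of _ 0]) auto

text \<open>A cover of \<open>S\<close> and a cover of \<open>S'\<close> together cover
  \<open>E\<close>, so ordinary subadditivity applies, and the two infima are taken one after the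
  other. Only \<open>E\<close> is Borel: \<open>S\<close> and \<open>S'\<close> will be deviation
  sets of an arbitrary \<open>g\<close>.\<close>

lemma le_outer_add:
  assumes "E \<in> \<B>" "E \<subseteq> S \<union> S'" "S \<subseteq> \<Omega>" "S' \<subseteq> \<Omega>"
  shows "\<mu> E \<le> outer_ba \<Omega> \<mu> S + outer_ba \<Omega> \<mu> S'"
proof -
  have ne: "{B \<in> \<B>. S \<subseteq> B} \<noteq> {}" "{B \<in> \<B>. S' \<subseteq> B} \<noteq> {}"
    using assms Omega_in by auto
  have *: "\<mu> E \<le> \<mu> B + \<mu> B'" if "B \<in> \<B>" "S \<subseteq> B" "B' \<in> \<B>" "S' \<subseteq> B'" for B B'
  proof -
    have "B \<union> B' \<in> \<B>" by (intro sets.Un that)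
    moreover have "E \<subseteq> B \<union> B'" using that assms(2) by blast
    ultimately have "\<mu> E \<le> \<mu> (B \<union> B')" using mono assms(1) by blast
    then show ?thesis using subadd[of B B'] that by linarith
  qed
  have "\<mu> E - outer_ba \<Omega> \<mu> S' \<le> outer_ba \<Omega> \<mu> S"
    unfolding outer_ba_def[of _ _ S]
  proof (rule cINF_greatest[OF ne(1)])
    fix B assume B: "B \<in> {B \<in> \<B>. S \<subseteq> B}"
    have "\<mu> E - \<mu> B \<le> outer_ba \<Omega> \<mu> S'"
      unfolding outer_ba_def
      by (rule cINF_greatest[OF ne(2)]) (use * B in force)
    then show "\<mu> E - outer_ba \<Omega> \<mu> S' \<le> \<mu> B" by simp
  qed
  then show ?thesis by simp
qed

text \<open>Smallness of the exceptional sets alone does not bound the integrals of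
  \<open>d k\<close>, since the bounds of the step functions may grow with \<open>k\<close>. The
  Cauchy conditions compare \<open>h k\<close> and \<open>h' k\<close> with members of a fixed index
  \<open>N\<close>, where the difference \<open>d N\<close> has a bound \<open>M\<close> that does
  not depend on \<open>k\<close>.\<close>

lemma determining_seq_unique:
  assumes h: "determining_seq \<Omega> \<mu> g h" and h': "determining_seq \<Omega> \<mu> g h'"
  shows "(\<lambda>k. step_integral \<Omega> \<mu> (h k) - step_integral \<Omega> \<mu> (h' k)) \<longlonglongrightarrow> 0"
proof -
  define d where "d k y = \<bar>h k y - h' k y\<bar>" for k y
  have sh: "simple (h k)" "simple (h' k)" for k
    using h h' by (auto simp: determining_seq_def)
  have sd: "simple (d k)" for k
    unfolding d_def using simple_function_compose2[OF sh, of "\<lambda>a b. \<bar>a - b\<bar>"] by simp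
  have sabs: "simple (\<lambda>y. \<bar>h k y - h l y\<bar>)" "simple (\<lambda>y. \<bar>h' k y - h' l y\<bar>)" for k l
    using simple_function_compose2[OF sh(1) sh(1), of "\<lambda>a b. \<bar>a - b\<bar>" k l]
      simple_function_compose2[OF sh(2) sh(2), of "\<lambda>a b. \<bar>a - b\<bar>" k l] by auto
  have "(\<lambda>k. step_integral \<Omega> \<mu> (d k)) \<longlonglongrightarrow> 0"
  proof (rule LIMSEQ_I)
    fix r :: real assume "r > 0"
    \<comment> \<open>The final estimate consists of \<open>2 * e * \<mu> \<Omega>\<close> and three
      further terms below \<open>e\<close>; the constant summand also keeps the denominator positive
      when \<open>\<mu> \<Omega> = 0\<close>.\<close>
    define e where "e = r / (2 * \<mu> \<Omega> + 4)"
    have m0: "\<mu> \<Omega> \<ge> 0" using nonneg[OF Omega_in] .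
    have e: "e > 0" using \<open>r > 0\<close> m0 by (simp add: e_def)
    obtain N1 where N1: "\<And>k l. k \<ge> N1 \<Longrightarrow> l \<ge> N1 \<Longrightarrow>
        \<bar>step_integral \<Omega> \<mu> (\<lambda>y. \<bar>h k y - h l y\<bar>)\<bar> < e"
      using h[unfolded determining_seq_def, THEN conjunct2, THEN conjunct2, rule_format, OF e]
      by metis
    obtain N2 where N2: "\<And>k l. k \<ge> N2 \<Longrightarrow> l \<ge> N2 \<Longrightarrow>
        \<bar>step_integral \<Omega> \<mu> (\<lambda>y. \<bar>h' k y - h' l y\<bar>)\<bar> < e"
      using h'[unfolded determining_seq_def, THEN conjunct2, THEN conjunct2, rule_format, OF e]
      by metis
    define N where "N = max N1 N2"
    have fin: "finite (d N ` \<Omega>)" using simple_functionD(1)[OF sd] by simp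
    \<comment> \<open>\<open>N\<close> is already fixed, so \<open>M\<close> is available before
      \<open>k\<close>, and the exceptional sets can then be required to have outer charge below
      \<open>e / M\<close>.\<close>
    obtain M where M: "\<And>y. y \<in> \<Omega> \<Longrightarrow> d N y \<le> M" "M > 0"
    proof (rule that[of "max 1 (Max (d N ` \<Omega>))"])
      show "d N y \<le> max 1 (Max (d N ` \<Omega>))" if "y \<in> \<Omega>" for y
        using that fin by (intro max.coboundedI2 Max_ge) auto
    qed auto
    define S where "S k = {y\<in>\<Omega>. \<bar>h k y - g y\<bar> > e}" for k
    define S' where "S' k = {y\<in>\<Omega>. \<bar>h' k y - g y\<bar> > e}" for k
    have "(\<lambda>k. outer_ba \<Omega> \<mu> (S k) + outer_ba \<Omega> \<mu> (S' k)) \<longlonglongrightarrow> 0 + 0"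
      using h h' e unfolding determining_seq_def S_def S'_def by (intro tendsto_add) auto
    then have "\<forall>\<^sub>F k in sequentially. outer_ba \<Omega> \<mu> (S k) + outer_ba \<Omega> \<mu> (S' k) < e / M"
      using e M(2) by (intro order_tendstoD) auto
    then obtain N3 where N3: "\<And>k. k \<ge> N3 \<Longrightarrow>
        outer_ba \<Omega> \<mu> (S k) + outer_ba \<Omega> \<mu> (S' k) < e / M"
      by (auto simp: eventually_sequentially)
    have "norm (step_integral \<Omega> \<mu> (d k) - 0) < r" if k: "k \<ge> max N N3" for k
    proof -
      define E where "E = {y\<in>\<Omega>. d k y > 2 * e}"
      have "E = d k -` {2 * e<..} \<inter> \<Omega>" by (auto simp: E_def)
      then have E: "E \<in> \<B>" using simple_functionD(2)[OF sd, of _ "{2 * e<..}"] by simp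
      have "E \<subseteq> S k \<union> S' k" by (auto simp: E_def S_def S'_def d_def)
      then have "\<mu> E \<le> outer_ba \<Omega> \<mu> (S k) + outer_ba \<Omega> \<mu> (S' k)"
        by (intro le_outer_add E) (auto simp: S_def S'_def)
      also have "\<dots> < e / M" using N3 k by simp
      finally have muE: "M * \<mu> E < e" using M(2) by (simp add: field_simps)
      define u where "u y = (if y \<in> E then M else 0)" for y
      have su: "simple u" unfolding u_def by (rule simple_indicator[OF E])
      \<comment> \<open>Off \<open>E\<close> the term \<open>2 * e\<close> suffices. On
        \<open>E\<close> the triangle inequality passes through index \<open>N\<close>, and
        \<open>M\<close> absorbs \<open>d N\<close>.\<close>
      have "step_integral \<Omega> \<mu> (d k) \<le> step_integral \<Omega> \<mu>
          (\<lambda>y. (2 * e + u y) + (\<bar>h k y - h N y\<bar> + \<bar>h' k y - h' N y\<bar>))"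
      proof (rule step_integral_mono[OF sd])
        show "simple (\<lambda>y. (2 * e + u y) + (\<bar>h k y - h N y\<bar> + \<bar>h' k y - h' N y\<bar>))"
          by (intro simple_function_add simple_function_const su sabs)
        fix y assume y: "y \<in> \<Omega>"
        show "d k y \<le> (2 * e + u y) + (\<bar>h k y - h N y\<bar> + \<bar>h' k y - h' N y\<bar>)"
        proof (cases "y \<in> E")
          case True
          then show ?thesis using M(1)[OF y] e by (auto simp: u_def d_def)
        next
          case False
          then show ?thesis using y by (auto simp: u_def E_def)
        qed
      qed
      also have "\<dots> = (2 * e * \<mu> \<Omega> + M * \<mu> E) + (step_integral \<Omega> \<mu> (\<lambda>y. \<bar>h k y - h N y\<bar>)
          + step_integral \<Omega> \<mu> (\<lambda>y. \<bar>h' k y - h' N y\<bar>))"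
        using step_integral_indicator[OF E, of M] su
        by (simp add: step_integral_add simple_function_add sabs step_integral_const
            flip: u_def)
      also have "\<dots> < (2 * e * \<mu> \<Omega> + e) + (e + e)"
        using N1[of k N] N2[of k N] muE k by (auto simp: N_def)
      also have "\<dots> \<le> e * (2 * \<mu> \<Omega> + 4)" using e by (simp add: algebra_simps)
      also have "\<dots> = r" using m0 by (simp add: e_def)
      finally have "step_integral \<Omega> \<mu> (d k) < r" .
      moreover have "0 \<le> step_integral \<Omega> \<mu> (d k)"
        using step_integral_mono[of "\<lambda>_. 0" "d k"] sd step_integral_const[of 0]
        by (simp add: d_def)
      ultimately show ?thesis by simp
    qed
    then show "\<exists>no. \<forall>n\<ge>no. norm (step_integral \<Omega> \<mu> (d n) - 0) < r" by blast
  qed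
  moreover have "\<bar>step_integral \<Omega> \<mu> (h k) - step_integral \<Omega> \<mu> (h' k)\<bar>
      \<le> step_integral \<Omega> \<mu> (d k)" for k
    using step_integral_abs_diff[OF sh, of k k] unfolding d_def[abs_def] .
  ultimately show ?thesis
    by (rule_tac Lim_null_comparison[OF always_eventually]) simp_all
qed

text \<open>Justifies the definite description: since any two determining sequences have
  asymptotically equal step integrals, one convergent sequence fixes the value.\<close>

lemma ba_integral_realI:
  assumes h: "determining_seq \<Omega> \<mu> g h" and lim: "(\<lambda>k. step_integral \<Omega> \<mu> (h k)) \<longlonglongrightarrow> I"
  shows "ba_integral_real \<Omega> \<mu> g = I"
  unfolding ba_integral_real_def
proof (rule the_equality)
  fix J assume "\<exists>h. determining_seq \<Omega> \<mu> g h \<and> (\<lambda>k. step_integral \<Omega> \<mu> (h k)) \<longlonglongrightarrow> J"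
  then obtain h' where h': "determining_seq \<Omega> \<mu> g h'" "(\<lambda>k. step_integral \<Omega> \<mu> (h' k)) \<longlonglongrightarrow> J"
    by blast
  have "(\<lambda>k. step_integral \<Omega> \<mu> (h k) - step_integral \<Omega> \<mu> (h' k)) \<longlonglongrightarrow> I - J"
    by (intro tendsto_diff lim h')
  then show "J = I"
    using determining_seq_unique[OF h h'(1)] LIMSEQ_unique by fastforce
qed (use assms in blast)

text \<open>A constant sequence trivially satisfies the Cauchy condition, so unbounded
  \<open>g\<close> are covered too. For a charge the hypothesis is weaker than equality off a set of
  charge zero: the deviation sets are null for each \<epsilon>, but their union over all \<epsilon>
  need not be.\<close>

lemma ba_integral_real_const_in_measure:
  assumes "\<And>\<epsilon>. \<epsilon> > 0 \<Longrightarrow> outer_ba \<Omega> \<mu> {y\<in>\<Omega>. \<bar>c - g y\<bar> > \<epsilon>} = 0"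
  shows "ba_integrable_real \<Omega> \<mu> g" "ba_integral_real \<Omega> \<mu> g = c * \<mu> \<Omega>"
proof -
  have "determining_seq \<Omega> \<mu> g (\<lambda>k y. c)"
    using assms step_integral_const[of 0] by (auto simp: determining_seq_def)
  then show "ba_integrable_real \<Omega> \<mu> g" "ba_integral_real \<Omega> \<mu> g = c * \<mu> \<Omega>"
    using ba_integral_realI[of g "\<lambda>k y. c" "c * \<mu> \<Omega>"]
    by (auto simp: ba_integrable_real_def step_integral_const)
qed

text \<open>Rounding to a grid of mesh \<open>1 / real (Suc k)\<close> converges uniformly off a
  Borel set of charge zero, and uniform closeness controls integrals because
  \<open>\<mu> \<Omega>\<close> is finite. Since \<open>T\<close> carries the whole charge, a bound
  on \<open>T\<close> suffices.\<close>

lemma ba_integral_real_bound: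
  assumes g: "g \<in> borel_measurable (lebesgue_on \<Omega>)"
    and T: "T \<in> \<B>" "\<mu> T = \<mu> \<Omega>"
    and bound: "AE y in lebesgue. y \<in> T \<longrightarrow> \<bar>g y - c\<bar> \<le> K"
    and K: "K \<ge> 0"
  shows "ba_integrable_real \<Omega> \<mu> g" "\<bar>ba_integral_real \<Omega> \<mu> g - c * \<mu> \<Omega>\<bar> \<le> K * \<mu> \<Omega>"
proof -
  have T': "T \<in> sets borel" "T \<subseteq> \<Omega>" using T borel_subsets_iff[OF Omega] by auto
  have m0: "\<mu> \<Omega> \<ge> 0" using nonneg[OF Omega_in] .
  \<comment> \<open>Step functions must be Borel, so \<open>g\<close> is extended by 0 to the whole
    space and replaced by a Borel function that agrees with it almost everywhere.\<close>
  have "(\<lambda>y. if y \<in> \<Omega> then g y else 0) \<in> borel_measurable lebesgue"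
    using g Omega by (simp add: borel_measurable_if_I sets_completionI_sets)
  then obtain g' where g' [measurable]: "g' \<in> borel_measurable lborel"
    and ae: "AE y in lborel. (if y \<in> \<Omega> then g y else 0) = g' y"
    using completion_ex_borel_measurable_real by blast
  have "AE y in lborel. y \<in> T \<longrightarrow> \<bar>g y - c\<bar> \<le> K"
    using bound AE_completion_iff by blast
  with ae have "AE y in lborel. (y \<in> \<Omega> \<longrightarrow> g' y = g y) \<and> (y \<in> T \<longrightarrow> \<bar>g y - c\<bar> \<le> K)"
    by eventually_elim auto
  then obtain N where N: "N \<in> null_sets lborel"
    and N': "\<And>y. y \<notin> N \<Longrightarrow> (y \<in> \<Omega> \<longrightarrow> g' y = g y) \<and> (y \<in> T \<longrightarrow> \<bar>g y - c\<bar> \<le> K)"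
    unfolding eventually_ae_filter by auto
  have Nb [measurable]: "N \<in> sets borel" using N by (auto simp: null_sets_def)
  note T'(1) [measurable]
  define U where "U = {y \<in> T. \<bar>g' y - c\<bar> \<le> K}"
  have U [measurable]: "U \<in> sets borel" unfolding U_def by measurable
  \<comment> \<open>Everything that can go wrong is collected here. \<open>\<Omega> - T\<close> has
    charge zero by additivity, and \<open>N \<inter> \<Omega>\<close> has charge zero because it is
    Lebesgue null.\<close>
  define Z where "Z = (\<Omega> - T) \<union> (N \<inter> \<Omega>)"
  have ZB: "Z \<in> \<B>" "N \<inter> \<Omega> \<in> \<B>" "\<Omega> - T \<in> \<B>"
    unfolding Z_def by (auto simp: borel_subsets_iff[OF Omega])
  have "\<mu> (N \<inter> \<Omega>) = 0"
  proof (rule null[OF ZB(2)])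
    have "N \<inter> \<Omega> \<in> null_sets lborel" using N Omega by (intro null_set_Int2) auto
    then show "emeasure lebesgue (N \<inter> \<Omega>) = 0"
      using null_sets_completionI by blast
  qed
  moreover have "\<mu> (\<Omega> - T) = 0"
    using union[OF T(1) ZB(3)] T T' by (simp add: Un_absorb1)
  ultimately have "\<mu> Z \<le> 0"
    using subadd[OF ZB(3,2)] by (simp add: Z_def)
  then have Z0: "\<mu> Z = 0" using nonneg[OF ZB(1)] by simp
  have ZU: "y \<in> U \<and> g' y = g y" if "y \<in> \<Omega>" "y \<notin> Z" for y
    using that N'[of y] by (auto simp: Z_def U_def)
  \<comment> \<open>The offset \<open>g' - c\<close> is rounded down, and \<open>c\<close> itself is
    the value off \<open>U\<close>. Thus the distance to \<open>c\<close> is controlled on all of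
    \<Omega>, not merely off \<open>Z\<close>, and the bound \<open>K\<close> leaves only finitely
    many values.\<close>
  define h where "h k y = c + (if y \<in> U then real_of_int \<lfloor>(g' y - c) * real (Suc k)\<rfloor> / real (Suc k) else 0)"
    for k y
  have h_near: "\<bar>h k y - g' y\<bar> \<le> 1 / real (Suc k)" if "y \<in> U" for k y
  proof -
    have "\<bar>real_of_int \<lfloor>(g' y - c) * real (Suc k)\<rfloor> - (g' y - c) * real (Suc k)\<bar> \<le> 1"
      by linarith
    then have "\<bar>real_of_int \<lfloor>(g' y - c) * real (Suc k)\<rfloor> - (g' y - c) * real (Suc k)\<bar> / real (Suc k)
        \<le> 1 / real (Suc k)"
      by (intro divide_right_mono) auto
    moreover have "h k y - g' y
        = (real_of_int \<lfloor>(g' y - c) * real (Suc k)\<rfloor> - (g' y - c) * real (Suc k)) / real (Suc k)"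
      using that by (simp add: h_def field_simps)
    ultimately show ?thesis by (simp add: abs_divide)
  qed
  have h_bound: "\<bar>h k y - c\<bar> \<le> K + 1 / real (Suc k)" for k y
  proof (cases "y \<in> U")
    case True
    then have "\<bar>g' y - c\<bar> \<le> K" by (simp add: U_def)
    then show ?thesis using h_near[OF True, of k] by linarith
  qed (use K in \<open>simp add: h_def\<close>)
  have sh: "simple (h k)" for k
  proof (rule simple_function_borel_measurable)
    have "h k \<in> borel_measurable borel" unfolding h_def by measurable
    then show "h k \<in> borel_measurable (restrict_space borel \<Omega>)"
      by (rule measurable_restrict_space1)
    define S where "S = {\<lfloor>-K * real (Suc k)\<rfloor> .. \<lfloor>K * real (Suc k)\<rfloor>}"
    have range: "h k y \<in> insert c ((\<lambda>i. c + real_of_int i / real (Suc k)) ` S)" for y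
    proof (cases "y \<in> U")
      case True
      then have "- K \<le> g' y - c" "g' y - c \<le> K" by (auto simp: U_def)
      then have "\<lfloor>(g' y - c) * real (Suc k)\<rfloor> \<in> S"
        unfolding S_def atLeastAtMost_iff by (intro conjI floor_mono mult_right_mono) auto
      then show ?thesis using True by (auto simp: h_def)
    qed (simp add: h_def)
    have "finite (insert c ((\<lambda>i. c + real_of_int i / real (Suc k)) ` S))"
      by (simp add: S_def)
    then show "finite (h k ` space (restrict_space borel \<Omega>))"
      by (rule finite_subset[OF image_subsetI[OF range]])
  qed
  have sabs: "simple (\<lambda>y. \<bar>h k y - h l y\<bar>)" for k l
    using simple_function_compose2[OF sh sh, of "\<lambda>a b. \<bar>a - b\<bar>" k l] by simp
  have close: "step_integral \<Omega> \<mu> (\<lambda>y. \<bar>h k y - h l y\<bar>)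
      \<le> (1 / real (Suc k) + 1 / real (Suc l)) * \<mu> \<Omega>" for k l
    unfolding step_integral_const[symmetric]
  proof (rule step_integral_mono[OF sabs])
    fix y
    show "\<bar>h k y - h l y\<bar> \<le> 1 / real (Suc k) + 1 / real (Suc l)"
    proof (cases "y \<in> U")
      case True
      then show ?thesis using h_near[OF True, of k] h_near[OF True, of l] by linarith
    qed (simp add: h_def)
  qed simp
  have cauchy: "\<exists>N. \<forall>k\<ge>N. \<forall>l\<ge>N. \<bar>step_integral \<Omega> \<mu> (\<lambda>y. \<bar>h k y - h l y\<bar>)\<bar> < \<epsilon>"
    if "\<epsilon> > 0" for \<epsilon>
  proof -
    have "\<epsilon> / (2 * \<mu> \<Omega> + 1) > 0" using that m0 by simp
    then obtain N where N: "inverse (real (Suc N)) < \<epsilon> / (2 * \<mu> \<Omega> + 1)"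
      using reals_Archimedean by blast
    have "\<bar>step_integral \<Omega> \<mu> (\<lambda>y. \<bar>h k y - h l y\<bar>)\<bar> < \<epsilon>" if "k \<ge> N" "l \<ge> N" for k l
    proof -
      have "1 / real (Suc k) \<le> 1 / real (Suc N)" "1 / real (Suc l) \<le> 1 / real (Suc N)"
        using that by (auto intro!: divide_left_mono)
      then have "(1 / real (Suc k) + 1 / real (Suc l)) * \<mu> \<Omega> \<le> (2 * (1 / real (Suc N))) * \<mu> \<Omega>"
        using m0 by (intro mult_right_mono) auto
      also have "\<dots> \<le> 1 / real (Suc N) * (2 * \<mu> \<Omega> + 1)"
        by (simp add: field_simps)
      also have "\<dots> < \<epsilon>" using N m0 by (simp add: field_simps)
      finally have "step_integral \<Omega> \<mu> (\<lambda>y. \<bar>h k y - h l y\<bar>) < \<epsilon>" using close[of k l] by simp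
      moreover have "0 \<le> step_integral \<Omega> \<mu> (\<lambda>y. \<bar>h k y - h l y\<bar>)"
        using step_integral_mono[of "\<lambda>_. 0", OF _ sabs, of k l] step_integral_const[of 0] by simp
      ultimately show ?thesis by simp
    qed
    then show ?thesis by blast
  qed
  have det: "determining_seq \<Omega> \<mu> g h"
    unfolding determining_seq_def
  proof (intro conjI allI impI)
    fix \<epsilon> :: real assume "\<epsilon> > 0"
    then obtain N where N: "inverse (real (Suc N)) < \<epsilon>"
      using reals_Archimedean by blast
    have "outer_ba \<Omega> \<mu> {y\<in>\<Omega>. \<bar>h k y - g y\<bar> > \<epsilon>} = 0" if "k \<ge> N" for k
    proof (rule antisym)
      have "inverse (real (Suc k)) \<le> inverse (real (Suc N))" using that by auto
      then have k: "1 / real (Suc k) < \<epsilon>" using N by (simp add: inverse_eq_divide)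
      have "{y\<in>\<Omega>. \<bar>h k y - g y\<bar> > \<epsilon>} \<subseteq> Z"
      proof
        fix y assume y: "y \<in> {y\<in>\<Omega>. \<bar>h k y - g y\<bar> > \<epsilon>}"
        show "y \<in> Z"
        proof (rule ccontr)
          assume "y \<notin> Z"
          then have "y \<in> U" "g' y = g y" using ZU[of y] y by auto
          then show False using h_near[of y k] k y by auto
        qed
      qed
      then show "outer_ba \<Omega> \<mu> {y\<in>\<Omega>. \<bar>h k y - g y\<bar> > \<epsilon>} \<le> 0"
        using outer_le[OF _ ZB(1)] Z0 by metis
    qed (rule outer_ge_0, blast)
    then show "(\<lambda>k. outer_ba \<Omega> \<mu> {y\<in>\<Omega>. \<bar>h k y - g y\<bar> > \<epsilon>}) \<longlonglongrightarrow> 0"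
      by (intro tendsto_eventually) (auto simp: eventually_sequentially)
  qed (use sh cauchy in auto)
  then show "ba_integrable_real \<Omega> \<mu> g"
    by (auto simp: ba_integrable_real_def)
  \<comment> \<open>A determining sequence makes the differences small in the integral sense; the
    limit of the step integrals themselves is obtained from completeness of the reals.\<close>
  have "Cauchy (\<lambda>k. step_integral \<Omega> \<mu> (h k))"
    unfolding Cauchy_def dist_real_def
    using cauchy step_integral_abs_diff[OF sh sh] by (meson abs_ge_self le_less_trans order_trans)
  then obtain I where I: "(\<lambda>k. step_integral \<Omega> \<mu> (h k)) \<longlonglongrightarrow> I"
    using Cauchy_convergent convergent_def by blast
  have "\<bar>step_integral \<Omega> \<mu> (h k) - c * \<mu> \<Omega>\<bar> \<le> (K + 1 / real (Suc k)) * \<mu> \<Omega>" for k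
  proof -
    have "\<bar>step_integral \<Omega> \<mu> (h k) - step_integral \<Omega> \<mu> (\<lambda>y. c)\<bar>
        \<le> step_integral \<Omega> \<mu> (\<lambda>y. \<bar>h k y - c\<bar>)"
      by (intro step_integral_abs_diff sh) simp
    also have "\<dots> \<le> step_integral \<Omega> \<mu> (\<lambda>y. K + 1 / real (Suc k))"
      using simple_function_compose1[OF sh, of "\<lambda>v. \<bar>v - c\<bar>" k] h_bound
      by (intro step_integral_mono) auto
    finally show ?thesis by (simp add: step_integral_const)
  qed
  moreover have "(\<lambda>k. \<bar>step_integral \<Omega> \<mu> (h k) - c * \<mu> \<Omega>\<bar>) \<longlonglongrightarrow> \<bar>I - c * \<mu> \<Omega>\<bar>"
    by (intro tendsto_intros I)
  moreover have "(\<lambda>k. (K + 1 / real (Suc k)) * \<mu> \<Omega>) \<longlonglongrightarrow> (K + 0) * \<mu> \<Omega>"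
    using LIMSEQ_inverse_real_of_nat by (intro tendsto_intros) (simp add: inverse_eq_divide)
  ultimately have "\<bar>I - c * \<mu> \<Omega>\<bar> \<le> (K + 0) * \<mu> \<Omega>"
    by (intro LIMSEQ_le) auto
  then show "\<bar>ba_integral_real \<Omega> \<mu> g - c * \<mu> \<Omega>\<bar> \<le> K * \<mu> \<Omega>"
    using ba_integral_realI[OF det I] by simp
qed

end

lemma Dens_charge: "\<Omega> \<in> sets borel \<Longrightarrow> \<mu> \<in> Dens \<Omega> y \<Longrightarrow> charge \<Omega> \<mu>"
  by unfold_locales (auto simp: Dens_def)

text \<open>The ball has full charge, so the local bound is enough. The scalar estimate holds for
  every component with the same \<open>K\<close>, and the sum of the components dominates the norm,
  whence the factor \<open>CARD('m)\<close>.\<close>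

lemma Dens_integral_bound:
  fixes f :: "real^'n \<Rightarrow> real^'m"
  assumes Omega: "\<Omega> \<in> sets borel" and \<mu>: "\<mu> \<in> Dens \<Omega> y"
    and f: "f \<in> borel_measurable (lebesgue_on \<Omega>)" and "r > 0" "K \<ge> 0"
    and bound: "AE z in lebesgue. z \<in> ball y r \<inter> \<Omega> \<longrightarrow> norm (f z - c) \<le> K"
  shows "ba_integrable \<Omega> \<mu> f" "norm (ba_integral \<Omega> \<mu> f - c) \<le> real CARD('m) * K"
proof -
  interpret charge \<Omega> \<mu> using Omega \<mu> by (rule Dens_charge)
  have T: "ball y r \<inter> \<Omega> \<in> \<B>" "\<mu> (ball y r \<inter> \<Omega>) = \<mu> \<Omega>" and 1: "\<mu> \<Omega> = 1"
    using Omega \<mu> \<open>r > 0\<close> by (auto simp: Dens_def borel_subsets_iff)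
  have g: "(\<lambda>z. f z $ i) \<in> borel_measurable (lebesgue_on \<Omega>)" for i
    using measurable_compose[OF f borel_measurable_nth] .
  have b: "AE z in lebesgue. z \<in> ball y r \<inter> \<Omega> \<longrightarrow> \<bar>f z $ i - c $ i\<bar> \<le> K" for i
    using bound
  proof eventually_elim
    case (elim z)
    then show ?case using component_le_norm_cart[of "f z - c" i] by auto
  qed
  note * = ba_integral_real_bound[OF g T b \<open>K \<ge> 0\<close>]
  show "ba_integrable \<Omega> \<mu> f" unfolding ba_integrable_def using *(1) by blast
  have "norm (ba_integral \<Omega> \<mu> f - c) \<le> (\<Sum>i\<in>UNIV. \<bar>(ba_integral \<Omega> \<mu> f - c) $ i\<bar>)"
    by (rule norm_le_l1_cart)
  also have "\<dots> \<le> (\<Sum>i\<in>(UNIV::'m set). K)"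
    using *(2) 1 by (intro sum_mono) (simp add: ba_integral_def)
  finally show "norm (ba_integral \<Omega> \<mu> f - c) \<le> real CARD('m) * K" by simp
qed

section \<open>Density points\<close>

lemma lmeasurable_Int_ball:
  assumes "S \<in> sets lebesgue"
  shows "S \<inter> ball y r \<in> lmeasurable"
  using assms by (intro bounded_set_imp_lmeasurable) (auto intro: bounded_subset[OF bounded_ball])

lemma measure_ball_pos:
  fixes y :: "'a::euclidean_space"
  shows "0 < r \<Longrightarrow> 0 < measure lebesgue (ball y r)"
  by (simp add: content_ball_pos)

text \<open>Vitali covering: enclose \<open>A\<close> in an open \<open>U\<close> with
  \<open>U - A\<close> small, and cover the exceptional set, up to a null set, by disjoint balls
  inside \<open>U\<close> having at least the share \<open>c\<close> of their volume in
  \<open>U - A\<close>. The balls then have total volume at most \<open>1 / c\<close> times that of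
  \<open>U - A\<close>. Measurability of the exceptional set never enters, since
  \<open>negligible_outer_le\<close> asks only for small measurable supersets.\<close>

lemma negligible_low_density:
  fixes A :: "'a::euclidean_space set"
  assumes A: "A \<in> sets lebesgue" and "c > 0"
  shows "negligible {y\<in>A. \<forall>d>0. \<exists>r. 0 < r \<and> r < d \<and>
    c * measure lebesgue (ball y r) \<le> measure lebesgue (ball y r - A)}" (is "negligible ?E")
  unfolding negligible_outer_le
proof (intro allI impI)
  fix e :: real assume "e > 0"
  \<comment> \<open>The excess \<open>c * e\<close> is chosen so that the factor \<open>c\<close>
    from the volume share cancels and leaves \<open>e\<close>.\<close>
  then obtain U where U: "open U" "A \<subseteq> U" "U - A \<in> lmeasurable"
    and mU: "emeasure lebesgue (U - A) < ennreal (c * e)"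
    using sets_lebesgue_outer_open[OF A, of "c * e"] \<open>c > 0\<close> by auto
  have mU: "measure lebesgue (U - A) \<le> c * e"
    using mU U(3) \<open>c > 0\<close> \<open>e > 0\<close> by (simp add: emeasure_eq_measure2 ennreal_less_iff)
  define K where "K = {(y, r). 0 < r \<and> ball y r \<subseteq> U \<and>
    c * measure lebesgue (ball y r) \<le> measure lebesgue (ball y r - A)}"
  have "\<exists>i. i \<in> K \<and> y \<in> ball (fst i) (snd i) \<and> snd i < d" if y: "y \<in> ?E" and "d > 0" for y d
  proof -
    have "y \<in> U" using U y by blast
    then obtain s where s: "s > 0" "ball y s \<subseteq> U"
      using U(1) openE by blast
    have "\<forall>d>0. \<exists>r. 0 < r \<and> r < d \<and>
        c * measure lebesgue (ball y r) \<le> measure lebesgue (ball y r - A)"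
      using y by simp
    moreover have "min d s > 0" using s \<open>d > 0\<close> by simp
    ultimately obtain r where r: "0 < r" "r < min d s"
      "c * measure lebesgue (ball y r) \<le> measure lebesgue (ball y r - A)"
      by metis
    then have "(y, r) \<in> K"
      using s subset_ball[of r s y] by (auto simp: K_def)
    then show ?thesis using r by (intro exI[of _ "(y, r)"]) auto
  qed
  then obtain C where C: "countable C" "C \<subseteq> K"
    and disj: "pairwise (\<lambda>i j. disjnt (ball (fst i) (snd i)) (ball (fst j) (snd j))) C"
    and cover: "negligible (?E - (\<Union>i\<in>C. ball (fst i) (snd i)))"
    using Vitali_covering_theorem_balls[of ?E K fst snd] by blast
  let ?B = "\<lambda>i. ball (fst i) (snd i)"
  have finite_bound: "measure lebesgue (\<Union>i\<in>F. ?B i) \<le> e" if F: "F \<subseteq> C" "finite F" for F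
  proof -
    have meas: "?B i - A \<in> lmeasurable" for i
      using A by (intro fmeasurable_Diff) auto
    have "c * measure lebesgue (\<Union>i\<in>F. ?B i) \<le> c * (\<Sum>i\<in>F. measure lebesgue (?B i))"
      using \<open>c > 0\<close> F by (intro mult_left_mono measure_UNION_le) auto
    also have "\<dots> \<le> (\<Sum>i\<in>F. measure lebesgue (?B i - A))"
      unfolding sum_distrib_left
      using F C(2) by (intro sum_mono) (auto simp: K_def)
    also have "\<dots> = measure lebesgue (\<Union>i\<in>F. ?B i - A)"
    proof (rule measure_UNION'[symmetric])
      show "pairwise (\<lambda>i j. disjnt (?B i - A) (?B j - A)) F"
        using pairwise_subset[OF disj F(1)] by (rule pairwise_mono) (auto simp: disjnt_def)
    qed (use meas F in auto)
    also have "\<dots> \<le> measure lebesgue (U - A)"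
    proof (rule measure_mono_fmeasurable[OF _ _ U(3)])
      have "?B i \<subseteq> U" if "i \<in> K" for i using that by (auto simp: K_def)
      then show "(\<Union>i\<in>F. ?B i - A) \<subseteq> U - A" using F C(2) by blast
      show "(\<Union>i\<in>F. ?B i - A) \<in> sets lebesgue"
        using F meas by (intro sets.finite_UN fmeasurableD)
    qed
    also have "\<dots> \<le> c * e" by (rule mU)
    finally show ?thesis using \<open>c > 0\<close> by simp
  qed
  \<comment> \<open>The estimate for all finite subfamilies passes to the countable union, and with
    it finiteness of the measure of \<open>V\<close>.\<close>
  define V where "V = (\<Union>i\<in>C. ?B i)"
  have V: "V \<in> lmeasurable" "measure lebesgue V \<le> e"
    unfolding V_def
    by (rule fmeasurable_UN_bound[OF C(1) _ finite_bound], simp, assumption+)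
      (rule measure_UN_bound[OF C(1) _ finite_bound], simp, assumption+)
  show "\<exists>T. ?E \<subseteq> T \<and> T \<in> lmeasurable \<and> measure lebesgue T \<le> e"
  proof (intro exI[of _ "V \<union> (?E - V)"] conjI)
    have n: "?E - V \<in> lmeasurable" "measure lebesgue (?E - V) = 0"
      using cover unfolding V_def
      by (auto simp: negligible_imp_measurable negligible_imp_measure0)
    show "V \<union> (?E - V) \<in> lmeasurable" using V n by (intro fmeasurable.Un)
    have "measure lebesgue (V \<union> (?E - V)) \<le> measure lebesgue V + measure lebesgue (?E - V)"
      using V n by (intro measure_Un_le) auto
    then show "measure lebesgue (V \<union> (?E - V)) \<le> e" using n V by linarith
  qed blast
qed

text \<open>A failure of convergence is witnessed at some threshold \<open>1 / real (Suc n)\<close>,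
  so countably many exceptional sets with fixed threshold cover all bad points.\<close>

theorem negligible_non_density_points:
  fixes A :: "'a::euclidean_space set"
  assumes A: "A \<in> sets lebesgue"
  shows "negligible {y\<in>A. \<not> ((\<lambda>r. measure lebesgue (ball y r - A) / measure lebesgue (ball y r))
    \<longlongrightarrow> 0) (at_right 0)}" (is "negligible ?N")
proof -
  let ?E = "\<lambda>c. {y\<in>A. \<forall>d>0. \<exists>r. 0 < r \<and> r < d \<and>
    c * measure lebesgue (ball y r) \<le> measure lebesgue (ball y r - A)}"
  have "?N \<subseteq> (\<Union>n. ?E (inverse (real (Suc n))))"
  proof
    fix y assume y: "y \<in> ?N"
    have "\<exists>n. y \<in> ?E (inverse (real (Suc n)))"
    proof (rule ccontr)
      assume no: "\<nexists>n. y \<in> ?E (inverse (real (Suc n)))"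
      have "((\<lambda>r. measure lebesgue (ball y r - A) / measure lebesgue (ball y r)) \<longlongrightarrow> 0) (at_right 0)"
      proof (rule tendstoI)
        fix e :: real assume "e > 0"
        then obtain n where n: "inverse (real (Suc n)) < e" using reals_Archimedean by blast
        obtain d where d: "d > 0" and *: "\<And>r. 0 < r \<Longrightarrow> r < d \<Longrightarrow>
            measure lebesgue (ball y r - A) < inverse (real (Suc n)) * measure lebesgue (ball y r)"
          using no y by (simp add: not_le) meson
        have "dist (measure lebesgue (ball y r - A) / measure lebesgue (ball y r)) 0 < e"
          if "0 < r" "r < d" for r
        proof -
          have pos: "measure lebesgue (ball y r) > 0" using that(1) by (rule measure_ball_pos)
          have "measure lebesgue (ball y r - A) / measure lebesgue (ball y r)
              < inverse (real (Suc n))"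
            using *[OF that] pos by (simp add: pos_divide_less_eq)
          then show ?thesis using n by (simp add: dist_real_def)
        qed
        then show "\<forall>\<^sub>F r in at_right 0.
            dist (measure lebesgue (ball y r - A) / measure lebesgue (ball y r)) 0 < e"
          unfolding eventually_at_right_field using d by blast
      qed
      then show False using y by simp
    qed
    then show "y \<in> (\<Union>n. ?E (inverse (real (Suc n))))" by blast
  qed
  moreover have "negligible (?E (inverse (real (Suc n))))" for n
    by (rule negligible_low_density[OF A]) simp
  then have "negligible (\<Union>n. ?E (inverse (real (Suc n))))"
    by (intro negligible_countable_Union) blast+
  ultimately show ?thesis using negligible_subset by blast
qed

text \<open>Passing from density in the whole space to density relative to \<Omega> could fail if
  \<Omega> were thin at \<open>y\<close>. But \<open>A\<close> itself lies in \<Omega> and fills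
  more than half of every small ball, so the two denominators differ by a factor of at most
  2.\<close>

lemma relative_density:
  assumes Omega: "\<Omega> \<in> sets borel" and A: "A \<in> sets lebesgue" "A \<subseteq> \<Omega>" and y: "y \<in> A"
    and dens: "((\<lambda>r. measure lebesgue (ball y r - A) / measure lebesgue (ball y r)) \<longlongrightarrow> 0) (at_right 0)"
  shows "y \<in> ess_closure \<Omega>" "(density_quotient \<Omega> y (\<Omega> - A) \<longlongrightarrow> 0) (at_right 0)"
proof -
  let ?m = "measure lebesgue"
  let ?q = "\<lambda>r. ?m (ball y r - A) / ?m (ball y r)"
  have OL: "\<Omega> \<in> sets lebesgue" using Omega by (simp add: sets_completionI_sets)
  have fm: "S \<inter> ball y r \<in> lmeasurable" if "S \<in> sets lebesgue" for S r
    using that by (rule lmeasurable_Int_ball)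
  have split: "?m (A \<inter> ball y r) = ?m (ball y r) - ?m (ball y r - A)" for r
  proof -
    have "?m (ball y r - (ball y r - A)) = ?m (ball y r) - ?m (ball y r - A)"
      using A by (intro measurable_measure_Diff) auto
    moreover have "ball y r - (ball y r - A) = A \<inter> ball y r" by auto
    ultimately show ?thesis by simp
  qed
  have mono: "?m (A \<inter> ball y r) \<le> ?m (\<Omega> \<inter> ball y s)" if "r \<le> s" for r s
    using that A subset_ball[OF that, of y] OL fm by (intro measure_mono_fmeasurable) auto
  have "\<forall>\<^sub>F r in at_right 0. ?q r < 1/2"
    using dens by (rule order_tendstoD) simp
  then obtain d where d: "d > 0" and q: "\<And>r. 0 < r \<Longrightarrow> r < d \<Longrightarrow> ?q r < 1/2"
    unfolding eventually_at_right_field by blast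
  have half: "?m (A \<inter> ball y r) > ?m (ball y r) / 2" if "0 < r" "r < d" for r
    using q[OF that] measure_ball_pos[OF that(1), of y] by (simp add: split pos_divide_less_eq)
  have pos: "?m (A \<inter> ball y r) > 0" if "0 < r" "r < d" for r
    using half[OF that] measure_ball_pos[OF that(1), of y] by linarith
  show "y \<in> ess_closure \<Omega>"
    unfolding ess_closure_def
  proof (intro CollectI conjI allI impI)
    show "y \<in> closure \<Omega>" using y A closure_subset by blast
    fix r :: real assume "r > 0"
    \<comment> \<open>Positivity is known only for radii below \<open>d\<close>; the radius is
      shrunk first, and monotonicity returns to \<open>r\<close>.\<close>
    then have "0 < min r (d/2)" "min r (d/2) < d" using d by auto
    from pos[OF this] show "0 < ?m (\<Omega> \<inter> ball y r)"
      using mono[of "min r (d/2)" r] by simp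
  qed
  show "(density_quotient \<Omega> y (\<Omega> - A) \<longlongrightarrow> 0) (at_right 0)"
  proof (rule Lim_null_comparison)
    show "((\<lambda>r. 2 * ?q r) \<longlongrightarrow> 0) (at_right 0)"
      using tendsto_mult_right_zero[OF dens, of 2] by simp
    have "norm (density_quotient \<Omega> y (\<Omega> - A) r) \<le> 2 * ?q r" if r: "0 < r" "r < d" for r
    proof -
      have "?m ((\<Omega> - A) \<inter> \<Omega> \<inter> ball y r) \<le> ?m (ball y r - A)"
        using A OL by (intro measure_mono_fmeasurable fmeasurable_Diff) auto
      moreover have "?m (\<Omega> \<inter> ball y r) \<ge> ?m (ball y r) / 2"
        using half[OF r] mono[of r r] by simp
      ultimately have "density_quotient \<Omega> y (\<Omega> - A) r \<le> ?m (ball y r - A) / (?m (ball y r) / 2)"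
        unfolding density_quotient_def using measure_ball_pos[OF r(1), of y]
        by (intro frac_le) auto
      then show ?thesis by (simp add: density_quotient_def mult.commute)
    qed
    then show "\<forall>\<^sub>F r in at_right 0. norm (density_quotient \<Omega> y (\<Omega> - A) r) \<le> 2 * ?q r"
      unfolding eventually_at_right_field using d by blast
  qed
qed

section \<open>Approximate continuity of measurable functions\<close>

lemma density_quotient_nonneg: "0 \<le> density_quotient \<Omega> y A r"
  by (simp add: density_quotient_def)

lemma density_quotient_mono:
  assumes "\<Omega> \<in> sets borel" "A \<inter> \<Omega> \<subseteq> B" "A \<in> sets lebesgue" "B \<in> sets lebesgue"
  shows "density_quotient \<Omega> y A r \<le> density_quotient \<Omega> y B r"
proof -
  have OL: "\<Omega> \<in> sets lebesgue" using assms by (simp add: sets_completionI_sets)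
  then have "measure lebesgue (A \<inter> \<Omega> \<inter> ball y r) \<le> measure lebesgue (B \<inter> \<Omega> \<inter> ball y r)"
    using assms(2) by (intro measure_mono_fmeasurable lmeasurable_Int_ball sets.Int assms OL) auto
  then show ?thesis unfolding density_quotient_def by (intro divide_right_mono) auto
qed

text \<open>Some rational interval around \<open>g y\<close> is so short that its preimage avoids
  the deviation set of size \<epsilon>. Outside the null set this preimage has density 1 at
  \<open>y\<close>, so the deviation set has density 0.\<close>

lemma AE_approximately_continuous:
  fixes g :: "real^'n \<Rightarrow> real"
  assumes Omega: "\<Omega> \<in> sets borel" and g: "g \<in> borel_measurable (lebesgue_on \<Omega>)"
  shows "AE y in lebesgue. y \<in> \<Omega> \<longrightarrow> y \<in> ess_closure \<Omega> \<and>
    (\<forall>\<epsilon>>0. (density_quotient \<Omega> y {z\<in>\<Omega>. \<bar>g y - g z\<bar> > \<epsilon>} \<longlongrightarrow> 0) (at_right 0))"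
proof -
  have OL: "\<Omega> \<in> sets lebesgue" using Omega by (simp add: sets_completionI_sets)
  have lev: "{z\<in>\<Omega>. P (g z)} \<in> sets lebesgue" if "Measurable.pred borel P" for P
  proof -
    have "{z \<in> space (lebesgue_on \<Omega>). P (g z)} \<in> sets (lebesgue_on \<Omega>)"
      using that g by measurable
    then show ?thesis using OL by (simp add: sets_restrict_space_iff)
  qed
  \<comment> \<open>Rational endpoints keep the family countable, so the exceptional sets of all
    preimages still form a null set.\<close>
  define A where "A p = {z\<in>\<Omega>. of_rat (fst p) < g z \<and> g z < of_rat (snd p)}" for p :: "rat \<times> rat"
  have A: "A p \<in> sets lebesgue" "A p \<subseteq> \<Omega>" for p
    unfolding A_def using lev[of "\<lambda>v. of_rat (fst p) < v \<and> v < of_rat (snd p)"] by auto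
  define N where "N p = {y\<in>A p. \<not> ((\<lambda>r. measure lebesgue (ball y r - A p) / measure lebesgue (ball y r))
    \<longlongrightarrow> 0) (at_right 0)}" for p
  have "negligible (N p)" for p
    unfolding N_def by (rule negligible_non_density_points[OF A(1)])
  then have "negligible (\<Union>p. N p)"
    by (intro negligible_countable_Union) auto
  then have "(\<Union>p. N p) \<in> null_sets lebesgue"
    by (simp add: negligible_iff_null_sets)
  then have "AE y in lebesgue. y \<notin> (\<Union>p. N p)"
    by (rule AE_not_in)
  then show ?thesis
  proof eventually_elim
    case (elim y)
    show ?case
    proof (intro impI)
      assume y: "y \<in> \<Omega>"
      have near: "\<exists>p. y \<in> A p \<and> (\<forall>z\<in>A p. \<bar>g y - g z\<bar> \<le> \<epsilon>)" if e: "\<epsilon> > 0" for \<epsilon>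
      proof -
        obtain a b where ab: "g y - \<epsilon>/2 < of_rat a" "of_rat a < g y" "g y < of_rat b" "of_rat b < g y + \<epsilon>/2"
          using of_rat_dense[of "g y - \<epsilon>/2" "g y"] of_rat_dense[of "g y" "g y + \<epsilon>/2"] e by auto
        have "y \<in> A (a, b)" "\<forall>z\<in>A (a, b). \<bar>g y - g z\<bar> \<le> \<epsilon>"
          using ab y by (auto simp: A_def)
        then show ?thesis by blast
      qed
      have *: "y \<in> ess_closure \<Omega>" "(density_quotient \<Omega> y (\<Omega> - A p) \<longlongrightarrow> 0) (at_right 0)"
        if p: "y \<in> A p" for p
      proof -
        have "((\<lambda>r. measure lebesgue (ball y r - A p) / measure lebesgue (ball y r))
            \<longlongrightarrow> 0) (at_right 0)"
          using elim p unfolding N_def by blast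
        from relative_density[OF Omega A p this]
        show "y \<in> ess_closure \<Omega>" "(density_quotient \<Omega> y (\<Omega> - A p) \<longlongrightarrow> 0) (at_right 0)" .
      qed
      have "(density_quotient \<Omega> y {z\<in>\<Omega>. \<bar>g y - g z\<bar> > \<epsilon>} \<longlongrightarrow> 0) (at_right 0)" if e: "\<epsilon> > 0" for \<epsilon>
      proof -
        obtain p where p: "y \<in> A p" "\<And>z. z \<in> A p \<Longrightarrow> \<bar>g y - g z\<bar> \<le> \<epsilon>"
          using near[OF e] by blast
        have "{z\<in>\<Omega>. \<bar>g y - g z\<bar> > \<epsilon>} \<subseteq> \<Omega> - A p" using p(2) by force
        moreover have "{z\<in>\<Omega>. \<bar>g y - g z\<bar> > \<epsilon>} \<in> sets lebesgue"
          using lev[of "\<lambda>v. \<bar>g y - v\<bar> > \<epsilon>"] by auto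
        ultimately have "norm (density_quotient \<Omega> y {z\<in>\<Omega>. \<bar>g y - g z\<bar> > \<epsilon>} r)
            \<le> density_quotient \<Omega> y (\<Omega> - A p) r" for r
          using density_quotient_mono[OF Omega, of "{z\<in>\<Omega>. \<bar>g y - g z\<bar> > \<epsilon>}" "\<Omega> - A p" y r] OL A
          by (auto simp: density_quotient_nonneg)
        then show ?thesis
          by (intro Lim_null_comparison[OF _ *(2)[OF p(1)]]) auto
      qed
      moreover have "y \<in> ess_closure \<Omega>"
        using near[of 1] * by auto
      ultimately show "y \<in> ess_closure \<Omega> \<and>
          (\<forall>\<epsilon>>0. (density_quotient \<Omega> y {z\<in>\<Omega>. \<bar>g y - g z\<bar> > \<epsilon>} \<longlongrightarrow> 0) (at_right 0))"
        by blast
    qed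
  qed
qed

section \<open>Density measures\<close>

lemma density_quotient_le_1:
  assumes "\<Omega> \<in> sets borel"
  shows "density_quotient \<Omega> y A r \<le> 1"
proof (cases "A \<inter> \<Omega> \<inter> ball y r \<in> sets lebesgue")
  case True
  have "\<Omega> \<inter> ball y r \<in> lmeasurable"
    using assms by (intro lmeasurable_Int_ball) (simp add: sets_completionI_sets)
  then have "measure lebesgue (A \<inter> \<Omega> \<inter> ball y r) \<le> measure lebesgue (\<Omega> \<inter> ball y r)"
    using True by (intro measure_mono_fmeasurable) auto
  then show ?thesis by (simp add: density_quotient_def divide_le_eq_1 zero_less_measure_iff)
qed (simp add: density_quotient_def measure_notin_sets)

lemma density_quotient_union:
  assumes "\<Omega> \<in> sets borel" "A \<in> sets lebesgue" "B \<in> sets lebesgue" "A \<inter> B = {}"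
  shows "density_quotient \<Omega> y (A \<union> B) r = density_quotient \<Omega> y A r + density_quotient \<Omega> y B r"
proof -
  have OL: "\<Omega> \<in> sets lebesgue" using assms by (simp add: sets_completionI_sets)
  have "measure lebesgue ((A \<inter> \<Omega> \<inter> ball y r) \<union> (B \<inter> \<Omega> \<inter> ball y r))
      = measure lebesgue (A \<inter> \<Omega> \<inter> ball y r) + measure lebesgue (B \<inter> \<Omega> \<inter> ball y r)"
    using assms OL by (intro measure_Un2[THEN trans] lmeasurable_Int_ball) (auto intro!: arg_cong[where f="measure lebesgue"])
  moreover have "(A \<union> B) \<inter> \<Omega> \<inter> ball y r = (A \<inter> \<Omega> \<inter> ball y r) \<union> (B \<inter> \<Omega> \<inter> ball y r)"
    by blast
  ultimately show ?thesis by (simp add: density_quotient_def add_divide_distrib)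
qed

lemma density_quotient_eq_1:
  assumes "y \<in> ess_closure \<Omega>" "0 < r" "r \<le> d"
  shows "density_quotient \<Omega> y (ball y d \<inter> \<Omega>) r = 1" "density_quotient \<Omega> y \<Omega> r = 1"
proof -
  have "ball y d \<inter> \<Omega> \<inter> \<Omega> \<inter> ball y r = \<Omega> \<inter> ball y r"
    using subset_ball[OF assms(3), of y] by blast
  moreover have "measure lebesgue (\<Omega> \<inter> ball y r) > 0"
    using assms by (auto simp: ess_closure_def)
  ultimately show "density_quotient \<Omega> y (ball y d \<inter> \<Omega>) r = 1" "density_quotient \<Omega> y \<Omega> r = 1"
    by (simp_all add: density_quotient_def)
qed

lemma borel_subsets_lebesgue: "\<Omega> \<in> sets borel \<Longrightarrow> A \<in> borel_subsets \<Omega> \<Longrightarrow> A \<in> sets lebesgue"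
  by (simp add: borel_subsets_iff sets_completionI_sets)

text \<open>A cluster point of the density quotients, as \<open>\<delta>\<close> tends to \<open>0\<close>, in the compact product
  of copies of \<open>[0,1]\<close> indexed by all sets.\<close>

lemma Leb_Dens_nonempty:
  assumes Omega: "\<Omega> \<in> sets borel" and y: "y \<in> ess_closure \<Omega>"
  shows "Leb_Dens \<Omega> y \<noteq> {}"
proof -
  define q where "q \<delta> A = density_quotient \<Omega> y A \<delta>" for \<delta> A
  let ?K = "PiE UNIV (\<lambda>_ :: (real^'n) set. {0..1::real})"
  have "compactin (product_topology (\<lambda>_. euclidean) UNIV) ?K"
    by (simp add: compactin_PiE)
  then have "compact ?K" by (simp add: euclidean_product_topology)
  moreover have "filtermap q (at_right 0) \<noteq> bot"
    by (simp add: filtermap_bot_iff)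
  moreover have "eventually (\<lambda>\<phi>. \<phi> \<in> ?K) (filtermap q (at_right 0))"
    by (simp add: eventually_filtermap PiE_UNIV_domain q_def density_quotient_nonneg density_quotient_le_1[OF Omega])
  ultimately obtain \<mu> where \<mu>: "\<mu> \<in> ?K" and "inf (nhds \<mu>) (filtermap q (at_right 0)) \<noteq> bot"
    unfolding compact_filter by blast
  define F where "F = inf (nhds \<mu>) (filtermap q (at_right 0))"
  have F: "F \<noteq> bot" unfolding F_def by fact
  have lim: "((\<lambda>\<phi>. \<phi> A) \<longlongrightarrow> \<mu> A) F" for A
  proof -
    have "eventually (\<lambda>\<phi>. \<phi> A \<in> S) F" if S: "open S" "\<mu> A \<in> S" for S
    proof -
      have "open ((\<lambda>\<phi>. \<phi> A) -` S)"
        using continuous_on_product_coordinates S(1) by (rule open_vimage[rotated])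
      then have "eventually (\<lambda>\<phi>. \<phi> A \<in> S) (nhds \<mu>)"
        unfolding eventually_nhds using S(2) by blast
      then show ?thesis unfolding F_def by (rule filter_leD[OF inf_le1])
    qed
    then show ?thesis by (rule topological_tendstoI)
  qed
  have ev: "eventually P F" if "\<forall>\<^sub>F \<delta> in at_right 0. P (q \<delta>)" for P
  proof (rule filter_leD)
    show "F \<le> filtermap q (at_right 0)" by (simp add: F_def)
    show "eventually P (filtermap q (at_right 0))" using that by (simp add: eventually_filtermap)
  qed
  have "\<mu> (A \<union> B) = \<mu> A + \<mu> B"
    if AB: "A \<in> borel_subsets \<Omega>" "B \<in> borel_subsets \<Omega>" "A \<inter> B = {}" for A B
  proof -
    \<comment> \<open>Additivity holds exactly for every \<delta>, so it survives the passage to the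
      limit along \<open>F\<close>.\<close>
    have "q \<delta> (A \<union> B) = q \<delta> A + q \<delta> B" for \<delta>
      unfolding q_def using AB by (intro density_quotient_union Omega borel_subsets_lebesgue[OF Omega])
    then have "\<forall>\<^sub>F \<phi> in F. \<phi> (A \<union> B) = \<phi> A + \<phi> B"
      by (intro ev always_eventually allI)
    then have "((\<lambda>\<phi>. \<phi> A + \<phi> B) \<longlongrightarrow> \<mu> (A \<union> B)) F"
      using lim[of "A \<union> B"] tendsto_cong by fastforce
    moreover have "((\<lambda>\<phi>. \<phi> A + \<phi> B) \<longlongrightarrow> \<mu> A + \<mu> B) F"
      by (intro tendsto_add lim)
    ultimately show ?thesis using F tendsto_unique by blast
  qed
  moreover have "\<mu> A = 0" if A: "A \<in> borel_subsets \<Omega>" "emeasure lebesgue A = 0" for A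
  proof -
    have "A \<in> null_sets lebesgue"
      using A borel_subsets_lebesgue[OF Omega A(1)] by (intro null_setsI)
    then have "A \<inter> (\<Omega> \<inter> ball y \<delta>) \<in> null_sets lebesgue" for \<delta>
      using Omega by (intro null_set_Int2 sets.Int) (auto simp: sets_completionI_sets)
    then have "q \<delta> A = 0" for \<delta>
      unfolding q_def density_quotient_def Int_assoc by (simp add: measure_eq_0_null_sets)
    then have "\<forall>\<^sub>F \<phi> in F. \<phi> A = 0"
      by (intro ev always_eventually allI)
    then have "((\<lambda>\<phi>. \<phi> A) \<longlongrightarrow> 0) F" by (rule tendsto_eventually)
    then show ?thesis using F lim[of A] tendsto_unique by blast
  qed
  moreover have "\<bar>\<mu> A\<bar> \<le> 1" for A
    using \<mu> by (auto simp: PiE_iff)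
  ultimately have "\<mu> \<in> ba \<Omega>" unfolding ba_def by blast
  moreover have "Liminf (at_right 0) (\<lambda>\<delta>. ereal (density_quotient \<Omega> y A \<delta>)) \<le> ereal (\<mu> A)" for A
  proof (rule ccontr)
    assume "\<not> ?thesis"
    \<comment> \<open>A real number strictly between the two sides would lie both below and above
      \<open>\<phi> A\<close> along \<open>F\<close>, which is impossible in a proper filter. The
      upper bound is treated symmetrically.\<close>
    then obtain c where c: "\<mu> A < c" "ereal c < Liminf (at_right 0) (\<lambda>\<delta>. ereal (density_quotient \<Omega> y A \<delta>))"
      using ereal_dense2[of "\<mu> A"] by (auto simp: not_le)
    have "\<forall>\<^sub>F \<phi> in F. c < \<phi> A"
      using less_LiminfD[OF c(2)] by (intro ev) (simp add: q_def)
    moreover have "\<forall>\<^sub>F \<phi> in F. \<phi> A < c"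
      using lim c(1) by (rule order_tendstoD)
    ultimately have "\<forall>\<^sub>F \<phi> in F. False" by eventually_elim simp
    then show False using F by (simp add: eventually_False)
  qed
  moreover have "ereal (\<mu> A) \<le> Limsup (at_right 0) (\<lambda>\<delta>. ereal (density_quotient \<Omega> y A \<delta>))" for A
  proof (rule ccontr)
    assume "\<not> ?thesis"
    then obtain c where c: "c < \<mu> A" "Limsup (at_right 0) (\<lambda>\<delta>. ereal (density_quotient \<Omega> y A \<delta>)) < ereal c"
      using ereal_dense2[of _ "\<mu> A"] by (auto simp: not_le)
    have "\<forall>\<^sub>F \<phi> in F. \<phi> A < c"
      using Limsup_lessD[OF c(2)] by (intro ev) (simp add: q_def)
    moreover have "\<forall>\<^sub>F \<phi> in F. c < \<phi> A"
      using lim c(1) by (rule order_tendstoD)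
    ultimately have "\<forall>\<^sub>F \<phi> in F. False" by eventually_elim simp
    then show False using F by (simp add: eventually_False)
  qed
  ultimately show ?thesis unfolding Leb_Dens_def by blast
qed

lemma Leb_Dens_eq_limit:
  assumes "\<mu> \<in> Leb_Dens \<Omega> y" "A \<in> borel_subsets \<Omega>"
    and "(density_quotient \<Omega> y A \<longlongrightarrow> l) (at_right 0)"
  shows "\<mu> A = l"
proof -
  have "((\<lambda>\<delta>. ereal (density_quotient \<Omega> y A \<delta>)) \<longlongrightarrow> ereal l) (at_right 0)"
    using assms(3) by simp
  from lim_imp_Liminf[OF _ this] lim_imp_Limsup[OF _ this] show ?thesis
    using assms(1,2) by (force simp: Leb_Dens_def)
qed

text \<open>Quotients are nonnegative, and the quotient of a fixed ball about \<open>y\<close> is 1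
  as soon as \<delta> drops below its radius; the defining bounds pass both facts on to \<mu>. This
  makes the estimates for \<open>Dens\<close> available for the measures behind
  \<open>pr\<close>.\<close>

lemma Leb_Dens_subset_Dens:
  assumes Omega: "\<Omega> \<in> sets borel" and y: "y \<in> ess_closure \<Omega>"
  shows "Leb_Dens \<Omega> y \<subseteq> Dens \<Omega> y"
proof
  fix \<mu> assume \<mu>: "\<mu> \<in> Leb_Dens \<Omega> y"
  have "0 \<le> \<mu> A" if "A \<in> borel_subsets \<Omega>" for A
  proof -
    have "ereal 0 \<le> Liminf (at_right 0) (\<lambda>\<delta>. ereal (density_quotient \<Omega> y A \<delta>))"
      by (intro Liminf_bounded) (simp add: density_quotient_nonneg)
    also have "\<dots> \<le> ereal (\<mu> A)" using \<mu> that by (auto simp: Leb_Dens_def)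
    finally show ?thesis by simp
  qed
  moreover have total: "\<mu> (ball y d \<inter> \<Omega>) = 1" "\<mu> \<Omega> = 1" if "d > 0" for d
  proof -
    have "\<forall>\<^sub>F r in at_right 0. density_quotient \<Omega> y (ball y d \<inter> \<Omega>) r = 1"
      "\<forall>\<^sub>F r in at_right 0. density_quotient \<Omega> y \<Omega> r = 1"
      unfolding eventually_at_right_field using density_quotient_eq_1[OF y] that
      by (metis less_imp_le)+
    then have "(density_quotient \<Omega> y (ball y d \<inter> \<Omega>) \<longlongrightarrow> 1) (at_right 0)"
      "(density_quotient \<Omega> y \<Omega> \<longlongrightarrow> 1) (at_right 0)"
      by (auto intro: tendsto_eventually)
    then show "\<mu> (ball y d \<inter> \<Omega>) = 1" "\<mu> \<Omega> = 1"
      using Omega by (auto intro!: Leb_Dens_eq_limit[OF \<mu>] simp: borel_subsets_iff)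
  qed
  ultimately show "\<mu> \<in> Dens \<Omega> y"
    using \<mu> total(2)[OF zero_less_one] by (auto simp: Dens_def Leb_Dens_def)
qed

text \<open>\<open>S\<close> is only Lebesgue measurable and \<mu> speaks about Borel sets. A Borel
  hull differs from \<open>S\<close> by a null set, hence has the same density quotients, and its
  charge bounds the outer charge of \<open>S\<close>.\<close>

lemma Leb_Dens_outer_eq_0:
  assumes Omega: "\<Omega> \<in> sets borel" and y: "y \<in> ess_closure \<Omega>" and \<mu>: "\<mu> \<in> Leb_Dens \<Omega> y"
    and S: "S \<in> sets lebesgue" "S \<subseteq> \<Omega>"
    and lim: "(density_quotient \<Omega> y S \<longlongrightarrow> 0) (at_right 0)"
  shows "outer_ba \<Omega> \<mu> S = 0"
proof -
  interpret charge \<Omega> \<mu>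
    using Leb_Dens_subset_Dens[OF Omega y] \<mu> Omega by (intro Dens_charge) auto
  obtain C where C: "C \<in> sets borel" "S \<subseteq> C" "C - S \<in> null_sets lebesgue"
  proof (rule completion_upper[OF S(1)])
    fix C assume "S \<subseteq> C" "C \<in> sets lborel" "C - S \<in> null_sets lebesgue"
    then show thesis by (intro that) auto
  qed
  have B: "C \<inter> \<Omega> \<in> \<B>"
    using C Omega by (auto simp: borel_subsets_iff)
  have OL: "\<Omega> \<in> sets lebesgue" using Omega by (simp add: sets_completionI_sets)
  have "density_quotient \<Omega> y (C \<inter> \<Omega>) r = density_quotient \<Omega> y S r" for r
  proof -
    have "C \<inter> \<Omega> \<inter> \<Omega> \<inter> ball y r = (S \<inter> \<Omega> \<inter> ball y r) \<union> ((C - S) \<inter> (\<Omega> \<inter> ball y r))"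
      using C(2) by blast
    moreover have "measure lebesgue ((S \<inter> \<Omega> \<inter> ball y r) \<union> ((C - S) \<inter> (\<Omega> \<inter> ball y r)))
        = measure lebesgue (S \<inter> \<Omega> \<inter> ball y r)"
      using OL by (intro measure_Un_null_set null_set_Int2 sets.Int S C(3)) auto
    ultimately show ?thesis by (simp add: density_quotient_def)
  qed
  then have "density_quotient \<Omega> y (C \<inter> \<Omega>) = density_quotient \<Omega> y S" by (rule ext)
  then have "(density_quotient \<Omega> y (C \<inter> \<Omega>) \<longlongrightarrow> 0) (at_right 0)"
    using lim by simp
  then have "\<mu> (C \<inter> \<Omega>) = 0" by (rule Leb_Dens_eq_limit[OF \<mu> B])
  then show ?thesis
    using outer_le[OF _ B, of S] outer_ge_0[OF S(2)] S(2) C(2) by force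
qed

text \<open>The quantifier over \<mu> stands inside the almost-everywhere statement: one null set
  serves all density measures at once, and therefore every selection.\<close>

lemma AE_ba_integral_Leb_Dens:
  fixes f :: "real^'n \<Rightarrow> real^'m"
  assumes Omega: "\<Omega> \<in> sets borel" and f: "f \<in> borel_measurable (lebesgue_on \<Omega>)"
  shows "AE y in lebesgue. y \<in> \<Omega> \<longrightarrow> y \<in> ess_closure \<Omega> \<and>
    (\<forall>\<mu>\<in>Leb_Dens \<Omega> y. ba_integral \<Omega> \<mu> f = f y)"
proof -
  have fi: "(\<lambda>z. f z $ i) \<in> borel_measurable (lebesgue_on \<Omega>)" for i
    using measurable_compose[OF f borel_measurable_nth] .
  have OL: "\<Omega> \<in> sets lebesgue" using Omega by (simp add: sets_completionI_sets)
  have "AE y in lebesgue. \<forall>i. y \<in> \<Omega> \<longrightarrow> y \<in> ess_closure \<Omega> \<and>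
    (\<forall>\<epsilon>>0. (density_quotient \<Omega> y {z\<in>\<Omega>. \<bar>f y $ i - f z $ i\<bar> > \<epsilon>} \<longlongrightarrow> 0) (at_right 0))"
    unfolding AE_all_countable using AE_approximately_continuous[OF Omega fi] by blast
  then show ?thesis
  proof eventually_elim
    case (elim y)
    show ?case
    proof (intro impI conjI ballI)
      assume y: "y \<in> \<Omega>"
      then show ye: "y \<in> ess_closure \<Omega>" using elim by blast
      fix \<mu> assume \<mu>: "\<mu> \<in> Leb_Dens \<Omega> y"
      have D: "\<mu> \<in> Dens \<Omega> y" using Leb_Dens_subset_Dens[OF Omega ye] \<mu> by blast
      interpret charge \<Omega> \<mu> using D Omega by (intro Dens_charge)
      have "outer_ba \<Omega> \<mu> {z\<in>\<Omega>. \<bar>f y $ i - f z $ i\<bar> > \<epsilon>} = 0" if "\<epsilon> > 0" for i \<epsilon>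
      proof (rule Leb_Dens_outer_eq_0[OF Omega ye \<mu>])
        have "{z \<in> space (lebesgue_on \<Omega>). \<bar>f y $ i - f z $ i\<bar> > \<epsilon>} \<in> sets (lebesgue_on \<Omega>)"
          using fi[of i] by measurable
        then show "{z\<in>\<Omega>. \<bar>f y $ i - f z $ i\<bar> > \<epsilon>} \<in> sets lebesgue"
          using OL by (simp add: sets_restrict_space_iff)
        show "(density_quotient \<Omega> y {z\<in>\<Omega>. \<bar>f y $ i - f z $ i\<bar> > \<epsilon>} \<longlongrightarrow> 0) (at_right 0)"
          using elim y that by blast
      qed blast
      then have "ba_integral_real \<Omega> \<mu> (\<lambda>z. f z $ i) = f y $ i * \<mu> \<Omega>" for i
        by (intro ba_integral_real_const_in_measure(2))
      then show "ba_integral \<Omega> \<mu> f = f y"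
        using D by (simp add: ba_integral_def vec_eq_iff Dens_def)
    qed
  qed
qed

section \<open>Differentiability\<close>

lemma AE_lebesgue_on_iff:
  assumes "S \<in> sets lebesgue"
  shows "(AE y in lebesgue_on S. P y) \<longleftrightarrow> (AE y in lebesgue. y \<in> S \<longrightarrow> P y)"
  using assms by (intro AE_restrict_space_iff) simp

lemma measurable_lebesgue_on_subset:
  assumes "f \<in> borel_measurable (lebesgue_on S)" "T \<subseteq> S"
  shows "f \<in> borel_measurable (lebesgue_on T)"
  using measurable_restrict_mono[OF assms] .

lemma has_ess_lim_iff:
  fixes g :: "real^'n \<Rightarrow> real^'m"
  assumes Omega: "\<Omega> \<in> sets borel" and x: "x \<in> ess_closure \<Omega>"
    and g: "g \<in> borel_measurable (lebesgue_on \<Omega>)"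
  shows "has_ess_lim \<Omega> g x \<beta> \<longleftrightarrow>
    (\<forall>\<epsilon>>0. \<exists>\<delta>>0. AE y in lebesgue. y \<in> ball x \<delta> \<inter> \<Omega> \<longrightarrow> norm (g y - \<beta>) \<le> \<epsilon>)"
proof -
  have sets: "ball x \<delta> \<inter> \<Omega> \<in> sets lebesgue" for \<delta>
    using Omega by (intro sets.Int) (auto simp: sets_completionI_sets)
  let ?u = "\<lambda>y. ereal (norm (g y - \<beta>))"
  have gm [measurable]: "g \<in> borel_measurable (lebesgue_on (ball x \<delta> \<inter> \<Omega>))" for \<delta>
    using g by (rule measurable_lebesgue_on_subset) blast
  have um: "?u \<in> borel_measurable (lebesgue_on (ball x \<delta> \<inter> \<Omega>))" for \<delta>
    by measurable
  define s where "s \<delta> = esssup (lebesgue_on (ball x \<delta> \<inter> \<Omega>)) ?u" for \<delta>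
  \<comment> \<open>Here \<open>x \<in> ess_closure \<Omega>\<close> is decisive: on a space of
    measure zero the essential supremum would be -\<infinity> and could not tend to 0.\<close>
  have s0: "0 \<le> s \<delta>" if "\<delta> > 0" for \<delta>
  proof -
    have "measure lebesgue (ball x \<delta> \<inter> \<Omega>) > 0"
      using x that unfolding ess_closure_def by (subst Int_commute) blast
    then have "emeasure lebesgue (ball x \<delta> \<inter> \<Omega>) \<noteq> 0"
      by (auto simp: measure_def)
    then have "emeasure (lebesgue_on (ball x \<delta> \<inter> \<Omega>)) (space (lebesgue_on (ball x \<delta> \<inter> \<Omega>))) \<noteq> 0"
      using sets[of \<delta>] by (simp add: emeasure_restrict_space space_restrict_space)
    then have "0 = esssup (lebesgue_on (ball x \<delta> \<inter> \<Omega>)) (\<lambda>y. 0 :: ereal)"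
      by (intro esssup_const[symmetric])
    also have "\<dots> \<le> s \<delta>" unfolding s_def by (intro esssup_mono) auto
    finally show ?thesis .
  qed
  have s_le: "s \<delta> \<le> ereal \<epsilon> \<longleftrightarrow> (AE y in lebesgue. y \<in> ball x \<delta> \<inter> \<Omega> \<longrightarrow> norm (g y - \<beta>) \<le> \<epsilon>)"
    for \<delta> \<epsilon>
  proof -
    have "s \<delta> \<le> ereal \<epsilon> \<longleftrightarrow> (AE y in lebesgue_on (ball x \<delta> \<inter> \<Omega>). norm (g y - \<beta>) \<le> \<epsilon>)"
    proof
      assume *: "s \<delta> \<le> ereal \<epsilon>"
      have "AE y in lebesgue_on (ball x \<delta> \<inter> \<Omega>). ?u y \<le> s \<delta>"
        unfolding s_def by (rule esssup_AE)
      then show "AE y in lebesgue_on (ball x \<delta> \<inter> \<Omega>). norm (g y - \<beta>) \<le> \<epsilon>"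
      proof eventually_elim
        case (elim y)
        then have "?u y \<le> ereal \<epsilon>" using * by (rule order_trans)
        then show ?case by simp
      qed
    next
      assume "AE y in lebesgue_on (ball x \<delta> \<inter> \<Omega>). norm (g y - \<beta>) \<le> \<epsilon>"
      then have "AE y in lebesgue_on (ball x \<delta> \<inter> \<Omega>). ?u y \<le> ereal \<epsilon>" by simp
      then show "s \<delta> \<le> ereal \<epsilon>" unfolding s_def using um by (intro esssup_I)
    qed
    then show ?thesis unfolding AE_lebesgue_on_iff[OF sets] .
  qed
  \<comment> \<open>Monotonicity in the radius turns a bound for one \<delta> into a bound for all
    smaller ones, as the limit at 0 demands.\<close>
  have s_mono: "s \<delta> \<le> ereal \<epsilon>" if "s \<delta>' \<le> ereal \<epsilon>" "\<delta> \<le> \<delta>'" for \<delta> \<delta>' \<epsilon>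
  proof -
    have "AE y in lebesgue. y \<in> ball x \<delta>' \<inter> \<Omega> \<longrightarrow> norm (g y - \<beta>) \<le> \<epsilon>"
      using that(1) s_le by blast
    then have "AE y in lebesgue. y \<in> ball x \<delta> \<inter> \<Omega> \<longrightarrow> norm (g y - \<beta>) \<le> \<epsilon>"
      by eventually_elim (use that(2) in auto)
    then show ?thesis using s_le by blast
  qed
  have "(s \<longlongrightarrow> 0) (at_right 0) \<longleftrightarrow> (\<forall>\<epsilon>>0. \<exists>\<delta>>0. s \<delta> \<le> ereal \<epsilon>)"
  proof (intro iffI allI impI)
    fix \<epsilon> :: real assume s: "(s \<longlongrightarrow> 0) (at_right 0)" and "\<epsilon> > 0"
    then have "\<forall>\<^sub>F \<delta> in at_right 0. s \<delta> < ereal \<epsilon>"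
      by (intro order_tendstoD(2)[OF s]) simp
    then obtain d where d: "d > 0" "\<And>\<delta>. 0 < \<delta> \<Longrightarrow> \<delta> < d \<Longrightarrow> s \<delta> < ereal \<epsilon>"
      unfolding eventually_at_right_field by blast
    then show "\<exists>\<delta>>0. s \<delta> \<le> ereal \<epsilon>"
      by (intro exI[of _ "d/2"]) (simp add: less_imp_le)
  next
    assume R: "\<forall>\<epsilon>>0. \<exists>\<delta>>0. s \<delta> \<le> ereal \<epsilon>"
    show "(s \<longlongrightarrow> 0) (at_right 0)"
    proof (rule order_tendstoI)
      fix a :: ereal assume a: "a < 0"
      have "\<forall>\<delta>>0. a < s \<delta>" using s0 a less_le_trans by blast
      then show "\<forall>\<^sub>F \<delta> in at_right 0. a < s \<delta>"
        unfolding eventually_at_right_field using zero_less_one by blast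
    next
      fix a :: ereal assume "0 < a"
      then obtain \<epsilon> where e: "0 < ereal \<epsilon>" "ereal \<epsilon> < a" using ereal_dense2 by blast
      then obtain d where "d > 0" "s d \<le> ereal \<epsilon>" using R by auto
      then have "\<forall>\<delta>>0. \<delta> < d \<longrightarrow> s \<delta> < a"
        using s_mono e(2) by (meson le_less_trans less_imp_le)
      then show "\<forall>\<^sub>F \<delta> in at_right 0. s \<delta> < a"
        unfolding eventually_at_right_field using \<open>d > 0\<close> by blast
    qed
  qed
  then show ?thesis
    unfolding has_ess_lim_def s_le[symmetric] s_def[abs_def] .
qed

lemma AE_lebesgue_neq: "AE y in lebesgue. y \<noteq> (x :: 'a::euclidean_space)"
proof -
  have "{x} \<in> null_sets lebesgue"
    by (simp flip: negligible_iff_null_sets)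
  then have "AE y in lebesgue. y \<notin> {x}" by (rule AE_not_in)
  then show ?thesis by simp
qed

lemma linear_borel_measurable:
  fixes L :: "real^'n \<Rightarrow> real^'m"
  shows "linear L \<Longrightarrow> L \<in> borel_measurable borel"
  by (intro borel_measurable_continuous_onI linear_continuous_on linear_conv_bounded_linear[THEN iffD1])

text \<open>The form without division is the one used in estimates. The two forms can differ only at
  \<open>y = x\<close>, where the quotient is 0 by convention, and a single point is null.\<close>

lemma has_ess_deriv_iff:
  fixes f :: "real^'n \<Rightarrow> real^'m"
  assumes Omega: "\<Omega> \<in> sets borel" and x: "x \<in> ess_closure \<Omega>"
    and f: "f \<in> borel_measurable (lebesgue_on \<Omega>)"
  shows "has_ess_deriv \<Omega> f x \<alpha> L \<longleftrightarrow> linear L \<and>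
    (\<forall>\<epsilon>>0. \<exists>\<delta>>0. AE y in lebesgue. y \<in> ball x \<delta> \<inter> \<Omega> \<longrightarrow>
      norm (f y - \<alpha> - L (y - x)) \<le> \<epsilon> * norm (y - x))"
proof (cases "linear L")
  case True
  have "(\<lambda>y. L (y - x)) \<in> borel_measurable borel"
    using linear_borel_measurable[OF True] by measurable
  then have [measurable]: "(\<lambda>y. L (y - x)) \<in> borel_measurable (lebesgue_on \<Omega>)"
    by (intro measurable_restrict_space1 measurable_completion) simp
  have [measurable]: "(\<lambda>y. norm (y - x)) \<in> borel_measurable (lebesgue_on \<Omega>)"
    by (intro measurable_restrict_space1 measurable_completion) simp
  note f [measurable]
  have m: "diff_quotient f x \<alpha> L \<in> borel_measurable (lebesgue_on \<Omega>)"
    unfolding diff_quotient_def[abs_def] by measurable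
  have "(AE y in lebesgue. y \<in> ball x \<delta> \<inter> \<Omega> \<longrightarrow> norm (diff_quotient f x \<alpha> L y - 0) \<le> \<epsilon>) \<longleftrightarrow>
    (AE y in lebesgue. y \<in> ball x \<delta> \<inter> \<Omega> \<longrightarrow> norm (f y - \<alpha> - L (y - x)) \<le> \<epsilon> * norm (y - x))"
    for \<delta> \<epsilon>
  proof (rule eventually_subst)
    show "\<forall>\<^sub>F y in ae_filter lebesgue.
      (y \<in> ball x \<delta> \<inter> \<Omega> \<longrightarrow> norm (diff_quotient f x \<alpha> L y - 0) \<le> \<epsilon>) =
      (y \<in> ball x \<delta> \<inter> \<Omega> \<longrightarrow> norm (f y - \<alpha> - L (y - x)) \<le> \<epsilon> * norm (y - x))"
      using AE_lebesgue_neq[of x]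
    proof eventually_elim
      case (elim y)
      then have "norm (y - x) > 0" by simp
      moreover have "norm (diff_quotient f x \<alpha> L y - 0) = norm (f y - \<alpha> - L (y - x)) / norm (y - x)"
        by (simp add: diff_quotient_def divide_inverse_commute)
      ultimately show ?case by (simp add: pos_divide_le_eq)
    qed
  qed
  then show ?thesis
    using True unfolding has_ess_deriv_def has_ess_lim_iff[OF Omega x m] by simp
qed (simp add: has_ess_deriv_def)

text \<open>Where \<open>pr_exists\<close> holds its witness is chosen; elsewhere any element of the
  nonempty set \<open>Leb_Dens \<Omega> y\<close> will do.\<close>

lemma dens_selection_exists:
  assumes "\<Omega> \<in> sets borel"
  shows "\<exists>dens. dens_selection \<Omega> f dens"
proof -
  have "\<forall>y\<in>ess_closure \<Omega>. \<exists>\<mu>. \<mu> \<in> Leb_Dens \<Omega> y \<and> (pr_exists \<Omega> f y \<longrightarrow> ba_integrable \<Omega> \<mu> f)"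
    using Leb_Dens_nonempty[OF assms] unfolding pr_exists_def by blast
  from bchoice[OF this] show ?thesis unfolding dens_selection_def by blast
qed

section \<open>Consequences of essential differentiability\<close>

locale ess_differentiable =
  fixes \<Omega> :: "(real^'n) set" and x :: "real^'n" and f :: "real^'n \<Rightarrow> real^'m"
    and \<alpha> :: "real^'m" and L :: "real^'n \<Rightarrow> real^'m"
  assumes Omega: "\<Omega> \<in> sets borel" and x: "x \<in> ess_closure \<Omega>"
    and f: "f \<in> borel_measurable (lebesgue_on \<Omega>)"
    and deriv: "has_ess_deriv \<Omega> f x \<alpha> L"
begin

lemma linear: "linear L"
  using deriv by (simp add: has_ess_deriv_def)

lemma AE_deriv:
  assumes "\<epsilon> > 0"
  obtains \<delta> where "\<delta> > 0" "AE y in lebesgue. y \<in> ball x \<delta> \<inter> \<Omega> \<longrightarrow>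
      norm (f y - \<alpha> - L (y - x)) \<le> \<epsilon> * norm (y - x)"
  using deriv assms unfolding has_ess_deriv_iff[OF Omega x f] by blast

lemma L_bound: "norm (L v) \<le> onorm L * norm v" and onorm_nonneg: "0 \<le> onorm L"
  using linear by (simp_all add: linear_conv_bounded_linear onorm onorm_pos_le)

lemma Leb_Dens_imp_Dens: "y \<in> ess_closure \<Omega> \<Longrightarrow> \<mu> \<in> Leb_Dens \<Omega> y \<Longrightarrow> \<mu> \<in> Dens \<Omega> y"
  using Leb_Dens_subset_Dens[OF Omega] by blast

lemma AE_near_alpha:
  assumes "\<epsilon> > 0"
  obtains \<delta> where "\<delta> > 0" "AE y in lebesgue. y \<in> ball x \<delta> \<inter> \<Omega> \<longrightarrow> norm (f y - \<alpha>) \<le> \<epsilon>"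
proof -
  obtain d where d: "d > 0" "AE y in lebesgue. y \<in> ball x d \<inter> \<Omega> \<longrightarrow>
      norm (f y - \<alpha> - L (y - x)) \<le> 1 * norm (y - x)"
    using AE_deriv[of 1] by auto
  \<comment> \<open>With tolerance 1 the derivative bound gives
    \<open>norm (f y - \<alpha>) \<le> (1 + onorm L) * norm (y - x)\<close>, which dictates the
    second radius.\<close>
  define \<delta> where "\<delta> = min d (\<epsilon> / (1 + onorm L))"
  have pos: "1 + onorm L > 0" using onorm_nonneg by simp
  have \<delta>: "\<delta> > 0" "\<delta> \<le> d" using d(1) assms pos by (simp_all add: \<delta>_def)
  have "\<delta> \<le> \<epsilon> / (1 + onorm L)" by (simp add: \<delta>_def)
  then have \<delta>_le: "(1 + onorm L) * \<delta> \<le> \<epsilon>"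
    using pos by (simp add: pos_le_divide_eq mult.commute)
  have "AE y in lebesgue. y \<in> ball x \<delta> \<inter> \<Omega> \<longrightarrow> norm (f y - \<alpha>) \<le> \<epsilon>"
    using d(2)
  proof eventually_elim
    case (elim y)
    show ?case
    proof
      assume y: "y \<in> ball x \<delta> \<inter> \<Omega>"
      then have n: "norm (y - x) \<le> \<delta>" by (auto simp: dist_norm norm_minus_commute)
      have "norm (f y - \<alpha>) \<le> norm (f y - \<alpha> - L (y - x)) + norm (L (y - x))"
        using norm_triangle_ineq[of "f y - \<alpha> - L (y - x)" "L (y - x)"] by simp
      also have "\<dots> \<le> (1 + onorm L) * norm (y - x)"
        using elim y \<delta>(2) L_bound[of "y - x"] by (auto simp: distrib_right)
      also have "\<dots> \<le> (1 + onorm L) * \<delta>"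
        using n onorm_nonneg by (intro mult_left_mono) auto
      finally show "norm (f y - \<alpha>) \<le> \<epsilon>" using \<delta>_le by linarith
    qed
  qed
  then show thesis using that \<delta>(1) by blast
qed

lemma Dens_integral:
  assumes \<mu>: "\<mu> \<in> Dens \<Omega> x"
  shows "ba_integrable \<Omega> \<mu> f" "ba_integral \<Omega> \<mu> f = \<alpha>"
proof -
  have *: "ba_integrable \<Omega> \<mu> f \<and> norm (ba_integral \<Omega> \<mu> f - \<alpha>) \<le> e" if "e > 0" for e
  proof -
    \<comment> \<open>Dividing by \<open>CARD('m)\<close> cancels the factor produced by
      \<open>Dens_integral_bound\<close>. Every measure in \<open>Dens \<Omega> x\<close> has full
      charge on every ball, so \<open>e\<close> may be arbitrarily small for the same \<mu>.\<close>
    have pos: "e / real CARD('m) > 0" using that by simp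
    obtain \<delta> where "\<delta> > 0" "AE y in lebesgue. y \<in> ball x \<delta> \<inter> \<Omega> \<longrightarrow> norm (f y - \<alpha>) \<le> e / real CARD('m)"
      using AE_near_alpha[OF pos] .
    from Dens_integral_bound[OF Omega \<mu> f this(1) less_imp_le[OF pos] this(2)]
    show ?thesis by simp
  qed
  show "ba_integrable \<Omega> \<mu> f" using *[of 1] by simp
  have "norm (ba_integral \<Omega> \<mu> f - \<alpha>) \<le> 0"
    by (rule field_le_epsilon) (use * in simp)
  then show "ba_integral \<Omega> \<mu> f = \<alpha>" by simp
qed

text \<open>The average differs from \<alpha> by the average of \<open>f - \<alpha>\<close>, which
  is essentially small near \<open>x\<close>. Integrability also comes from the essential bound on
  sets of finite measure, since a ball intersected with \<Omega> need not lie in a compact subset of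
  \<Omega>.\<close>

lemma has_star_value: "has_star_value \<Omega> f x \<alpha>"
proof -
  have B: "ball x \<delta> \<inter> \<Omega> \<in> lmeasurable" for \<delta>
    using lmeasurable_Int_ball[of \<Omega> x \<delta>] Omega by (simp add: Int_commute sets_completionI_sets)
  have pos: "measure lebesgue (ball x \<delta> \<inter> \<Omega>) > 0" if "\<delta> > 0" for \<delta>
    using x that unfolding ess_closure_def by (subst Int_commute) blast
  have fm: "f \<in> borel_measurable (lebesgue_on (ball x \<delta> \<inter> \<Omega>))" for \<delta>
    using f by (rule measurable_lebesgue_on_subset) blast
  have fin: "finite_measure (lebesgue_on (ball x \<delta> \<inter> \<Omega>))" for \<delta>
    using B by (intro finite_measure_lebesgue_on)
  have bd: "AE y in lebesgue_on (ball x \<delta> \<inter> \<Omega>). norm (f y - \<alpha>) \<le> \<epsilon>"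
    if "AE y in lebesgue. y \<in> ball x d \<inter> \<Omega> \<longrightarrow> norm (f y - \<alpha>) \<le> \<epsilon>" "\<delta> \<le> d" for d \<delta> \<epsilon>
  proof -
    have "AE y in lebesgue. y \<in> ball x \<delta> \<inter> \<Omega> \<longrightarrow> norm (f y - \<alpha>) \<le> \<epsilon>"
      using that(1) by eventually_elim (use that(2) in auto)
    then show ?thesis using B by (subst AE_lebesgue_on_iff) (auto simp: fmeasurable_def)
  qed
  have int: "integrable (lebesgue_on (ball x \<delta> \<inter> \<Omega>)) (\<lambda>y. f y - \<alpha>)"
    if "AE y in lebesgue_on (ball x \<delta> \<inter> \<Omega>). norm (f y - \<alpha>) \<le> \<epsilon>" for \<delta> \<epsilon>
    by (intro finite_measure.integrable_const_bound[OF fin that]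
        borel_measurable_diff fm borel_measurable_const)
  have const: "integrable (lebesgue_on (ball x \<delta> \<inter> \<Omega>)) (\<lambda>y. c)" for \<delta> and c :: "'c::{banach, second_countable_topology}"
    using finite_measure.integrable_const[OF fin] .
  have intf: "integrable (lebesgue_on (ball x \<delta> \<inter> \<Omega>)) f"
    if "AE y in lebesgue_on (ball x \<delta> \<inter> \<Omega>). norm (f y - \<alpha>) \<le> \<epsilon>" for \<delta> \<epsilon>
    using Bochner_Integration.integrable_add[OF int[OF that] const[of \<delta> \<alpha>]] by simp
  have meas: "measure (lebesgue_on (ball x \<delta> \<inter> \<Omega>)) (ball x \<delta> \<inter> \<Omega>)
      = measure lebesgue (ball x \<delta> \<inter> \<Omega>)" for \<delta>
    using B by (subst measure_restrict_space) (auto simp: fmeasurable_def)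
  let ?avg = "\<lambda>\<delta>. (1 / measure lebesgue (ball x \<delta> \<inter> \<Omega>)) *\<^sub>R
            integral\<^sup>L (lebesgue_on (ball x \<delta> \<inter> \<Omega>)) f"
  have avg: "norm (?avg \<delta> - \<alpha>) \<le> \<epsilon>"
    if "\<delta> > 0" and b: "AE y in lebesgue_on (ball x \<delta> \<inter> \<Omega>). norm (f y - \<alpha>) \<le> \<epsilon>" for \<delta> \<epsilon>
  proof -
    let ?M = "lebesgue_on (ball x \<delta> \<inter> \<Omega>)" and ?m = "measure lebesgue (ball x \<delta> \<inter> \<Omega>)"
    have "integral\<^sup>L ?M (\<lambda>y. f y - \<alpha>) = integral\<^sup>L ?M f - ?m *\<^sub>R \<alpha>"
      using Bochner_Integration.integral_diff[OF intf[OF b] const[of \<delta> \<alpha>]] by (simp add: meas)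
    then have "?avg \<delta> - \<alpha> = (1 / ?m) *\<^sub>R integral\<^sup>L ?M (\<lambda>y. f y - \<alpha>)"
      using pos[OF \<open>\<delta> > 0\<close>] by (simp add: scaleR_diff_right)
    then have "norm (?avg \<delta> - \<alpha>) = norm (integral\<^sup>L ?M (\<lambda>y. f y - \<alpha>)) / ?m"
      by simp
    also have "norm (integral\<^sup>L ?M (\<lambda>y. f y - \<alpha>)) \<le> integral\<^sup>L ?M (\<lambda>y. norm (f y - \<alpha>))"
      by (rule integral_norm_bound)
    also have "\<dots> \<le> integral\<^sup>L ?M (\<lambda>y. \<epsilon>)"
      using int[OF b] const[of \<delta> \<epsilon>] b by (intro integral_mono_AE) auto
    also have "\<dots> = \<epsilon> * ?m" by (simp add: meas)
    finally show ?thesis using pos[OF \<open>\<delta> > 0\<close>] by (simp add: divide_right_mono)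
  qed
  obtain d where d: "d > 0" "AE y in lebesgue. y \<in> ball x d \<inter> \<Omega> \<longrightarrow> norm (f y - \<alpha>) \<le> 1"
    using AE_near_alpha[of 1] by auto
  have "\<forall>\<^sub>F \<delta> in at_right 0. integrable (lebesgue_on (ball x \<delta> \<inter> \<Omega>)) f"
    unfolding eventually_at_right_field using d intf bd by (meson less_imp_le)
  moreover have "(?avg \<longlongrightarrow> \<alpha>) (at_right 0)"
  proof (rule tendstoI)
    fix e :: real assume "e > 0"
    then obtain d where d: "d > 0" "AE y in lebesgue. y \<in> ball x d \<inter> \<Omega> \<longrightarrow> norm (f y - \<alpha>) \<le> e/2"
      using AE_near_alpha[of "e/2"] by auto
    have "dist (?avg \<delta>) \<alpha> < e" if "0 < \<delta>" "\<delta> < d" for \<delta>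
      using avg[OF that(1) bd[OF d(2) less_imp_le[OF that(2)]]] \<open>e > 0\<close> by (simp add: dist_norm)
    then show "\<forall>\<^sub>F \<delta> in at_right 0. dist (?avg \<delta>) \<alpha> < e"
      unfolding eventually_at_right_field using d(1) by blast
  qed
  ultimately show ?thesis unfolding has_star_value_def by blast
qed

lemma value_identities: "value_identities \<Omega> f x \<alpha>"
  unfolding value_identities_def
proof (intro conjI allI impI ballI)
  show "has_ess_lim \<Omega> f x \<alpha>"
    unfolding has_ess_lim_iff[OF Omega x f]
  proof (intro allI impI)
    fix \<epsilon> :: real assume "\<epsilon> > 0"
    then obtain \<delta> where "\<delta> > 0" "AE y in lebesgue. y \<in> ball x \<delta> \<inter> \<Omega> \<longrightarrow> norm (f y - \<alpha>) \<le> \<epsilon>"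
      by (rule AE_near_alpha)
    then show "\<exists>\<delta>>0. AE y in lebesgue. y \<in> ball x \<delta> \<inter> \<Omega> \<longrightarrow> norm (f y - \<alpha>) \<le> \<epsilon>"
      by blast
  qed
  show "pr_exists \<Omega> f x"
    using Leb_Dens_nonempty[OF Omega x] Leb_Dens_imp_Dens[OF x] Dens_integral(1)
    unfolding pr_exists_def by blast
  show "pr \<Omega> dens f x = \<alpha>" if "dens_selection \<Omega> f dens" for dens
    using that x Leb_Dens_imp_Dens[OF x] Dens_integral(2)
    unfolding dens_selection_def pr_def by blast
qed (simp_all add: has_star_value Dens_integral)

text \<open>A measure concentrated at \<open>y\<close> sees \<open>f\<close> only near
  \<open>y\<close>, where the affine function is almost the constant
  \<open>\<alpha> + L (y - x)\<close>. The replacement error must stay proportional to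
  \<open>norm (y - x)\<close>, so the radius scales with this distance and \<open>y = x\<close> is
  excluded.\<close>

lemma Dens_integral_near:
  assumes ae: "AE z in lebesgue. z \<in> ball x \<delta> \<inter> \<Omega> \<longrightarrow>
      norm (f z - \<alpha> - L (z - x)) \<le> \<epsilon> * norm (z - x)"
    and y: "y \<in> ball x \<delta>" "y \<noteq> x" and \<mu>: "\<mu> \<in> Dens \<Omega> y" and "\<epsilon> > 0"
  shows "ba_integrable \<Omega> \<mu> f"
    "norm (ba_integral \<Omega> \<mu> f - \<alpha> - L (y - x)) \<le> real CARD('m) * (2 * \<epsilon> * norm (y - x))"
proof -
  have pos: "norm (y - x) > 0" using y by simp
  \<comment> \<open>The first term keeps the ball about \<open>y\<close> inside
    \<open>ball x \<delta>\<close>. The second makes \<open>(\<epsilon> + onorm L) * r\<close>, the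
    cost of moving from \<open>z\<close> to \<open>y\<close>, at most
    \<open>\<epsilon> * norm (y - x)\<close>; this is the second half of the factor 2.\<close>
  define r where "r = min (\<delta> - norm (y - x)) (\<epsilon> * norm (y - x) / (\<epsilon> + onorm L))"
  have eL: "\<epsilon> + onorm L > 0" using \<open>\<epsilon> > 0\<close> onorm_nonneg by simp
  have yd: "norm (y - x) < \<delta>" using y by (simp add: dist_norm norm_minus_commute)
  have r: "r > 0" "r \<le> \<delta> - norm (y - x)"
    using pos yd eL \<open>\<epsilon> > 0\<close> by (auto simp: r_def)
  have "r \<le> \<epsilon> * norm (y - x) / (\<epsilon> + onorm L)" by (simp add: r_def)
  then have r': "(\<epsilon> + onorm L) * r \<le> \<epsilon> * norm (y - x)"
    using eL by (simp add: pos_le_divide_eq mult.commute)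
  have "AE z in lebesgue. z \<in> ball y r \<inter> \<Omega> \<longrightarrow>
      norm (f z - (\<alpha> + L (y - x))) \<le> 2 * \<epsilon> * norm (y - x)"
    using ae
  proof eventually_elim
    case (elim z)
    show ?case
    proof
      assume z: "z \<in> ball y r \<inter> \<Omega>"
      then have zy: "norm (z - y) \<le> r" "norm (z - y) < r" by (auto simp: dist_norm norm_minus_commute)
      have zx: "norm (z - x) \<le> norm (y - x) + norm (z - y)"
        using norm_triangle_ineq[of "y - x" "z - y"] by simp
      then have "z \<in> ball x \<delta> \<inter> \<Omega>"
        using zy r z by (auto simp: dist_norm norm_minus_commute)
      then have 1: "norm (f z - \<alpha> - L (z - x)) \<le> \<epsilon> * norm (z - x)" using elim by blast
      have "L (z - x) = L (z - y) + L (y - x)"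
        using linear_add[OF linear, of "z - y" "y - x"] by simp
      then have "f z - (\<alpha> + L (y - x)) = (f z - \<alpha> - L (z - x)) + L (z - y)"
        by simp
      then have "norm (f z - (\<alpha> + L (y - x))) \<le> norm (f z - \<alpha> - L (z - x)) + norm (L (z - y))"
        using norm_triangle_ineq[of "f z - \<alpha> - L (z - x)" "L (z - y)"] by metis
      also have "\<dots> \<le> \<epsilon> * (norm (y - x) + r) + onorm L * r"
      proof (intro add_mono)
        show "norm (f z - \<alpha> - L (z - x)) \<le> \<epsilon> * (norm (y - x) + r)"
          using 1 zx zy(1) \<open>\<epsilon> > 0\<close>
          by (meson add_left_mono less_imp_le mult_left_mono order_trans)
        show "norm (L (z - y)) \<le> onorm L * r"
          using L_bound[of "z - y"] zy(1) onorm_nonneg by (meson mult_left_mono order_trans)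
      qed
      also have "\<dots> \<le> 2 * \<epsilon> * norm (y - x)"
        using r' by (simp add: algebra_simps)
      finally show "norm (f z - (\<alpha> + L (y - x))) \<le> 2 * \<epsilon> * norm (y - x)" .
    qed
  qed
  from Dens_integral_bound[OF Omega \<mu> f r(1) _ this] \<open>\<epsilon> > 0\<close>
  show "ba_integrable \<Omega> \<mu> f"
    "norm (ba_integral \<Omega> \<mu> f - \<alpha> - L (y - x)) \<le> real CARD('m) * (2 * \<epsilon> * norm (y - x))"
    by (simp_all add: diff_diff_eq)
qed

lemma has_precise_deriv: "has_precise_deriv \<Omega> f x \<alpha> L"
  unfolding has_precise_deriv_def
proof (intro conjI linear)
  obtain \<delta> where \<delta>: "\<delta> > 0" "AE z in lebesgue. z \<in> ball x \<delta> \<inter> \<Omega> \<longrightarrow>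
      norm (f z - \<alpha> - L (z - x)) \<le> 1 * norm (z - x)"
    using AE_deriv[of 1] by auto
  have "pr_exists \<Omega> f y" if y: "y \<in> ball x \<delta> \<inter> ess_closure \<Omega>" for y
  proof -
    obtain \<mu> where \<mu>: "\<mu> \<in> Leb_Dens \<Omega> y" using Leb_Dens_nonempty[OF Omega] y by blast
    then have D: "\<mu> \<in> Dens \<Omega> y" using Leb_Dens_imp_Dens y by blast
    have "ba_integrable \<Omega> \<mu> f"
      \<comment> \<open>The centre \<open>x\<close> belongs to the neighbourhood on which
        \<open>pr f\<close> must exist, and is handled by the estimate at \<open>x\<close>
        itself.\<close>
      using Dens_integral(1) Dens_integral_near(1)[OF \<delta>(2) _ _ D] D y by (cases "y = x") auto
    then show ?thesis using \<mu> unfolding pr_exists_def by blast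
  qed
  then show "\<exists>\<delta>>0. \<forall>y\<in>ball x \<delta> \<inter> ess_closure \<Omega>. pr_exists \<Omega> f y"
    using \<delta>(1) by blast
  obtain dens where dens: "dens_selection \<Omega> f dens"
    using dens_selection_exists[OF Omega] by blast
  have "(diff_quotient (pr \<Omega> dens f) x \<alpha> L \<longlongrightarrow> 0) (at x within \<Omega> \<inter> ess_closure \<Omega>)"
  proof (rule tendstoI)
    fix e :: real assume "e > 0"
    \<comment> \<open>\<open>Dens_integral_near\<close> costs the factor
      \<open>2 * CARD('m)\<close>; doubling it in the denominator leaves \<open>e / 2\<close> and
      hence a strict inequality.\<close>
    define \<epsilon> where "\<epsilon> = e / (4 * real CARD('m))"
    have \<epsilon>: "\<epsilon> > 0" "real CARD('m) * (2 * \<epsilon>) < e" using \<open>e > 0\<close> by (simp_all add: \<epsilon>_def)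
    obtain \<delta> where \<delta>: "\<delta> > 0" "AE z in lebesgue. z \<in> ball x \<delta> \<inter> \<Omega> \<longrightarrow>
        norm (f z - \<alpha> - L (z - x)) \<le> \<epsilon> * norm (z - x)"
      using AE_deriv[OF \<epsilon>(1)] .
    have "dist (diff_quotient (pr \<Omega> dens f) x \<alpha> L y) 0 < e"
      if y: "y \<in> \<Omega> \<inter> ess_closure \<Omega>" "y \<noteq> x" "dist y x < \<delta>" for y
    proof -
      have "dens y \<in> Dens \<Omega> y"
        using dens y Leb_Dens_imp_Dens unfolding dens_selection_def by blast
      then have "norm (pr \<Omega> dens f y - \<alpha> - L (y - x)) \<le> real CARD('m) * (2 * \<epsilon> * norm (y - x))"
        unfolding pr_def using y \<epsilon>(1)
        by (intro Dens_integral_near(2)[OF \<delta>(2)]) (auto simp: dist_commute)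
      moreover have "norm (y - x) > 0" using y by simp
      ultimately have "norm (diff_quotient (pr \<Omega> dens f) x \<alpha> L y) \<le> real CARD('m) * (2 * \<epsilon>)"
        by (simp add: diff_quotient_def divide_inverse_commute[symmetric] pos_divide_le_eq mult.assoc)
      then show ?thesis using \<epsilon>(2) by simp
    qed
    then show "\<forall>\<^sub>F y in at x within \<Omega> \<inter> ess_closure \<Omega>.
        dist (diff_quotient (pr \<Omega> dens f) x \<alpha> L y) 0 < e"
      unfolding eventually_at using \<delta>(1) by blast
  qed
  then show "\<exists>dens. dens_selection \<Omega> f dens \<and>
      (diff_quotient (pr \<Omega> dens f) x \<alpha> L \<longlongrightarrow> 0) (at x within \<Omega> \<inter> ess_closure \<Omega>)"
    using dens by blast
qed

end

text \<open>Shared by both converse directions: \<open>g\<close> is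
  \<open>pr \<Omega> dens f\<close> with \<open>S = \<Omega> \<inter> ess_closure \<Omega>\<close>,
  or a representative with \<open>S = \<Omega>\<close>. In each case almost every point of \<Omega>
  lies in \<open>S\<close> and \<open>g\<close> agrees with \<open>f\<close> there.\<close>

lemma has_ess_deriv_if_tendsto:
  fixes f :: "real^'n \<Rightarrow> real^'m"
  assumes Omega: "\<Omega> \<in> sets borel" and x: "x \<in> ess_closure \<Omega>"
    and f: "f \<in> borel_measurable (lebesgue_on \<Omega>)"
    and "linear L" and lim: "(diff_quotient g x \<alpha> L \<longlongrightarrow> 0) (at x within S)"
    and eq: "AE y in lebesgue. y \<in> \<Omega> \<longrightarrow> y \<in> S \<and> g y = f y"
  shows "has_ess_deriv \<Omega> f x \<alpha> L"
  unfolding has_ess_deriv_iff[OF Omega x f]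
proof (intro conjI allI impI \<open>linear L\<close>)
  fix e :: real assume "e > 0"
  with lim have "\<forall>\<^sub>F y in at x within S. dist (diff_quotient g x \<alpha> L y) 0 < e"
    by (rule tendstoD)
  then obtain d where d: "d > 0" and
    *: "\<And>y. y \<in> S \<Longrightarrow> y \<noteq> x \<Longrightarrow> dist y x < d \<Longrightarrow> norm (diff_quotient g x \<alpha> L y) < e"
    unfolding eventually_at by auto
  have "AE y in lebesgue. y \<in> ball x d \<inter> \<Omega> \<longrightarrow> norm (f y - \<alpha> - L (y - x)) \<le> e * norm (y - x)"
    using eq AE_lebesgue_neq[of x]
  proof eventually_elim
    case (elim y)
    show ?case
    proof
      assume y: "y \<in> ball x d \<inter> \<Omega>"
      then have "norm (diff_quotient g x \<alpha> L y) < e"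
        using elim by (intro *) (auto simp: dist_commute)
      moreover have "norm (y - x) > 0" using elim by simp
      ultimately show "norm (f y - \<alpha> - L (y - x)) \<le> e * norm (y - x)"
        using elim y by (simp add: diff_quotient_def divide_inverse_commute[symmetric] pos_divide_less_eq)
    qed
  qed
  then show "\<exists>\<delta>>0. AE y in lebesgue. y \<in> ball x \<delta> \<inter> \<Omega> \<longrightarrow>
      norm (f y - \<alpha> - L (y - x)) \<le> e * norm (y - x)"
    using d by blast
qed

theorem theorem5p16:
  fixes \<Omega> :: "(real^'n) set" and x :: "real^'n"
    and f :: "real^'n \<Rightarrow> real^'m" and \<alpha> :: "real^'m"
  assumes "\<Omega> \<in> sets borel"
    and "x \<in> ess_closure \<Omega>"
    and "f \<in> L1_loc \<Omega>"
  shows "((\<exists>L. has_ess_deriv \<Omega> f x \<alpha> L) \<longleftrightarrow> (\<exists>L. has_precise_deriv \<Omega> f x \<alpha> L)) \<and>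
     ((\<exists>L. has_ess_deriv \<Omega> f x \<alpha> L) \<longrightarrow>
        (\<forall>L. has_precise_deriv \<Omega> f x \<alpha> L \<longleftrightarrow> has_ess_deriv \<Omega> f x \<alpha> L) \<and>
        value_identities \<Omega> f x \<alpha>) \<and>
     (\<forall>f' L. representative_of \<Omega> f f' \<and> has_pointwise_deriv \<Omega> f' x \<alpha> L \<longrightarrow>
        has_precise_deriv \<Omega> f x \<alpha> L \<and> value_identities \<Omega> f x \<alpha>)"
proof -
  have f: "f \<in> borel_measurable (lebesgue_on \<Omega>)"
    using assms(3) by (simp add: L1_loc_def)
  have ess: "has_precise_deriv \<Omega> f x \<alpha> L \<and> value_identities \<Omega> f x \<alpha>"
    if "has_ess_deriv \<Omega> f x \<alpha> L" for L
  proof -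
    interpret ess_differentiable \<Omega> x f \<alpha> L
      by unfold_locales (use assms f that in auto)
    show ?thesis using has_precise_deriv value_identities by blast
  qed
  have precise: "has_ess_deriv \<Omega> f x \<alpha> L" if L: "has_precise_deriv \<Omega> f x \<alpha> L" for L
  proof -
    obtain dens where "linear L" and dens: "dens_selection \<Omega> f dens"
      and lim: "(diff_quotient (pr \<Omega> dens f) x \<alpha> L \<longlongrightarrow> 0) (at x within \<Omega> \<inter> ess_closure \<Omega>)"
      using L unfolding has_precise_deriv_def by blast
    \<comment> \<open>Specializing the inner quantifier over measures to \<open>dens y\<close> keeps
      the null set independent of the selection. It also shows that almost every point of \<Omega>
      belongs to the set on which the limit is taken.\<close>
    have "AE y in lebesgue. y \<in> \<Omega> \<longrightarrow> y \<in> \<Omega> \<inter> ess_closure \<Omega> \<and> pr \<Omega> dens f y = f y"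
      using AE_ba_integral_Leb_Dens[OF assms(1) f]
    proof eventually_elim
      case (elim y)
      then show ?case using dens unfolding dens_selection_def pr_def by blast
    qed
    then show ?thesis
      using has_ess_deriv_if_tendsto[OF assms(1,2) f \<open>linear L\<close> lim] by blast
  qed
  have pointwise: "has_ess_deriv \<Omega> f x \<alpha> L"
    if "representative_of \<Omega> f f'" and L: "has_pointwise_deriv \<Omega> f' x \<alpha> L" for f' L
  proof -
    have "AE y in lebesgue. y \<in> \<Omega> \<longrightarrow> y \<in> \<Omega> \<and> f' y = f y"
      using that(1) assms(1) by (simp add: representative_of_def AE_lebesgue_on_iff sets_completionI_sets)
    then show ?thesis
      using L has_ess_deriv_if_tendsto[OF assms(1,2) f]
      unfolding has_pointwise_deriv_def by blast
  qed
  show ?thesis using ess precise pointwise by blast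
qed

end
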